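(* Let $K$ be an algebraically closed field of characteristic zero and let $f\in K(\!(x^{1/q})\!)$ have class in $R_q^{o}(x)\setminus\{0\}$ and $\operatorname{ord}(f)=-p/q$. Then the following equalities of plane curve germs hold (germs being identified up to multiplication by units, and variables being renamed as indicated). (1) Suppose $p<q$. Let $g\in K(\!(x_1^{1/(q-p)})\!)$ be the series attached to $\mathcal{F}^{(\infty,0)}$, so that $\mathcal{F}^{(\infty,0)}(E_{f,q})\cong E_{\dot g,q-p}$ with $\dot g=g+\frac{p}{2(q-p)}$. Then $$C_{g,q-p}(x_1,-y_1)=\sigma_2^{*}(C_{f,q}(x,y)).$$ (2) Let $g\in K(\!(x_1^{1/(p+q)})\!)$ be the series attached to $\mathcal{F}^{(0,\infty)}$, so that $\mathcal{F}^{(0,\infty)}(E_{f,q})\cong E_{\dot g,p+q}$ with $\dot g=g+\frac{p}{2(p+q)}$. Then $$C_{f,q}(-x,y)=\sigma_2^{*}(C_{g,p+q}(x_1,y_1)).$$ (3) Suppose $p>q$. Let $g\in K(\!(x_1^{1/(p-q)})\!)$ be the series attached to $\mathcal{F}^{(\infty,\infty)}$, so that $\mathcal{F}^{(\infty,\infty)}(E_{f,q})\cong E_{\dot g,p-q}$ with $\dot g=g+\frac{p}{2(p-q)}$. Then $$C_{g,p-q}(x_1,-y_1)=\sigma_3^{*}(C_{f,q}(x,y)).$$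
   Context: For $q\in\mathbb{Z}_{>0}$ and $f\in K(\!(x^{1/q})\!)$, $E_{f,q}=(V,\nabla)$ is the $K(\!(x)\!)$-connection with $V=K(\!(x^{1/q})\!)$ as a $K(\!(x)\!)$-vector space and $\nabla(v)=(\frac{d}{dx}+x^{-1}f)v$. The order $\operatorname{ord}(f)$ is the lowest exponent of $x$ occurring in $f$ with nonzero coefficient. Put $R_q(x)=K(\!(x^{1/q})\!)/\left(x^{1/q}K[\![x^{1/q}]\!]+\frac1q\mathbb{Z}\right)$; $R_q^{o}(x)$ is the set of elements of $R_q(x)$ that cannot be represented by elements of $K(\!(x^{1/r})\!)$ for any $0<r<q$. Associated curve: $C_{f,q}(x,y)=\prod_{i=1}^{q}\left(y-\frac{1}{f(\zeta_q^i x^{1/q})}\right)$, $\zeta_q$ a primitive $q$-th root of unity; similarly for $C_{g,r}$ with $g\in K(\!(x_1^{1/r})\!)$. Local Fourier transforms and the attached series $g$ (explicit form of Fang and Sabbah): write $t=x^{1/q}$ and $f=f(t)\in K(\!(t)\!)$, $\operatorname{ord}_t f=-p$. In each case below, solve the equation for $\theta\in tK[\![t]\!]$ (with nonzero linear coefficient), invert to get $t=t(\theta)$, and define $g$ as a Laurent series in $\theta$, where $\theta$ is the indicated root of the new variable $x_1$ (the choice of root in solving for $\theta$ affects neither $E_{\dot g}$ up to isomorphism nor $C_g$): - $\mathcal{F}^{(\infty,0)}$ ($p<q$): $x_1=\theta^{q-p}=t^qf(t)$, $g(\theta)=-f(t(\theta))$, and $\mathcal{F}^{(\infty,0)}(E_{f,q})\cong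 E_{\dot g,q-p}$ with $\dot g=g+\frac{p}{2(q-p)}$. - $\mathcal{F}^{(0,\infty)}$: $x_1=\theta^{p+q}=-t^q/f(t)$, $g(\theta)=f(t(\theta))$, and $\mathcal{F}^{(0,\infty)}(E_{f,q})\cong E_{\dot g,p+q}$ with $\dot g=g+\frac{p}{2(p+q)}$. - $\mathcal{F}^{(\infty,\infty)}$ ($p>q$): $x_1=\theta^{p-q}=1/(t^qf(t))$, $g(\theta)=-f(t(\theta))$, and $\mathcal{F}^{(\infty,\infty)}(E_{f,q})\cong E_{\dot g,p-q}$ with $\dot g=g+\frac{p}{2(p-q)}$. Transforms of curves: two elements of $K[\![x,y]\!]$ define the same germ if they differ by a unit factor. For $C(x,y)\in K[\![x,y]\!]$ of multiplicity $k$ (lowest degree of a nonzero homogeneous part), the strict transform is $\sigma_2^{*}(C)(x_1,y_1)=y_1^{-k}C(x_1y_1,y_1)$; it is a power series in two variables, whose variables are renamed $(x,y)$ in (2), where the source variables are $(x_1,y_1)$. For an irreducible germ $C(x,y)$ with a good (i.e. primitive) parametrization $x=t^{m}\alpha(t)$, $y=t^{n}$, $\alpha\in K[\![t]\!]$, $\alpha(0)\ne0$, $m\le n$, the germ $\sigma_3^{*}(C)(x_1,y_1)$ is the irreducible germ with good parametrization $x_1=t^{n-m}\alpha(t)^{-1}$, $y_1=t^{n}$ (corresponding to $x\mapsto x_1^{-1}y_1$, $y\mapsto y_1$). *)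

theory Defs
  imports "HOL-Computational_Algebra.Computational_Algebra"
begin

section \<open>Laurent series in a root of the variable\<close>

text \<open>
  An element of K((x^(1/q))) is given as a Laurent series in t = x^(1/q), i.e. as a term
  of type \<^typ>\<open>'a fls\<close>; its order in x is \<^term>\<open>fls_subdegree f\<close> divided by q.
\<close>

text \<open>The elements of K((x^(1/q))) that lie in K((x^(1/r))): the exponent n of t stands for
  the exponent n/q of x, which has to be an integral multiple of 1/r.\<close>
definition in_root_field :: "nat \<Rightarrow> nat \<Rightarrow> 'a::zero fls set" where
  "in_root_field q r = {h. \<forall>n. fls_nth h n \<noteq> 0 \<longrightarrow> int q dvd n * int r}"

text \<open>The subgroup x^(1/q) K[[x^(1/q)]] + (1/q) Z.\<close>
definition R_modulus :: "nat \<Rightarrow> 'a::field_char_0 fls set" where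
  "R_modulus q = {fps_to_fls (fps_X * h) + fls_const (of_int k / of_nat q) | h k. True}"

definition R_class :: "nat \<Rightarrow> 'a::field_char_0 fls \<Rightarrow> 'a fls set" where
  "R_class q f = {h. h - f \<in> R_modulus q}"

definition R_quot :: "nat \<Rightarrow> 'a::field_char_0 fls set set" where
  "R_quot q = range (R_class q)"

definition R_o :: "nat \<Rightarrow> 'a::field_char_0 fls set set" where
  "R_o q = {c \<in> R_quot q. \<forall>r. 0 < r \<and> r < q \<longrightarrow> \<not> (\<exists>h\<in>in_root_field q r. c = R_class q h)}"

section \<open>Power series in two variables and germs\<close>

text \<open>
  A power series C(x,y) is a term of type \<^typ>\<open>'a fps fps\<close>: the outer variable is y and
  the coefficients are power series in x, so that the coefficient of x^a y^b is
  \<^term>\<open>fps_nth (fps_nth C b) a\<close>.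
\<close>

definition germ :: "'a::field fps fps \<Rightarrow> 'a fps fps set" where
  "germ C = {u * C | u. u dvd 1}"

definition negate_x :: "'a::field fps fps \<Rightarrow> 'a fps fps" where
  "negate_x C = Abs_fps (\<lambda>b. fps_nth C b oo (- fps_X))"

definition negate_y :: "'a::field fps fps \<Rightarrow> 'a fps fps" where
  "negate_y C = C oo (- fps_X)"

text \<open>C(X(t),Y(t)), for X and Y without constant term. As Y^b has order at least b, the
  summands with b > n do not contribute to the coefficient of t^n.\<close>
definition eval_at :: "'a::field fps fps \<Rightarrow> 'a fps \<Rightarrow> 'a fps \<Rightarrow> 'a fps" where
  "eval_at C X Y = Abs_fps (\<lambda>n. \<Sum>b\<le>n. fps_nth ((fps_nth C b oo X) * Y ^ b) n)"

section \<open>The associated curve\<close>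

definition primitive_root :: "nat \<Rightarrow> 'a::field \<Rightarrow> bool" where
  "primitive_root q z \<longleftrightarrow> z ^ q = 1 \<and> (\<forall>k. 0 < k \<and> k < q \<longrightarrow> z ^ k \<noteq> 1)"

definition zeta :: "nat \<Rightarrow> 'a::field" where
  "zeta q = (SOME z. primitive_root q z)"

lemma primitive_root_dvd:
  assumes "primitive_root q z" "q > 0" "z ^ k = 1"
  shows "q dvd k"
proof -
  have "z ^ k = (z ^ q) ^ (k div q) * z ^ (k mod q)"
    by (metis mult_div_mod_eq power_add power_mult)
  hence "z ^ (k mod q) = 1"
    using assms by (simp add: primitive_root_def)
  moreover have "k mod q < q" using assms by simp
  ultimately have "k mod q = 0" using assms by (auto simp: primitive_root_def)
  thus ?thesis by auto
qed

lemma primitive_root_exists: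
  assumes "q > 0"
  shows "\<exists>z::'a::{alg_closed_field, field_char_0}. primitive_root q z"
  using assms
proof (induction q rule: less_induct)
  case (less q)
  show ?case
  proof (cases "q = 1")
    case True
    thus ?thesis by (auto simp: primitive_root_def intro!: exI[of _ 1])
  next
    case False
    then obtain l where l: "prime l" "l dvd q" using prime_factor_nat by blast
    then obtain m where q: "q = l * m" by auto
    have m: "m > 0" "m < q" "l > 1" using q less.prems l prime_gt_1_nat[of l] by auto
    obtain w :: 'a where w: "primitive_root m w" using less.IH m by blast
    hence wm: "w ^ m = 1" by (simp add: primitive_root_def)
    obtain e :: 'a where e: "e ^ l = 1" "e \<noteq> 1"
    proof -
      define P :: "'a poly" where "P = (\<Sum>i<l. monom 1 i)"
      have c: "coeff P i = (if i < l then 1 else 0)" for i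
        by (simp add: P_def coeff_sum)
      have "l - 1 \<le> degree P" using m by (intro le_degree) (simp add: c)
      hence "degree P > 0" using m by simp
      then obtain e where "poly P e = 0" using alg_closed_imp_poly_has_root by blast
      hence "(\<Sum>i<l. e ^ i) = 0" by (simp add: P_def poly_sum poly_monom)
      moreover from this have "e ^ l - 1 = 0" by (simp add: power_diff_1_eq)
      ultimately show ?thesis using that[of e] m by (cases "e = 1") auto
    qed
    have ek: "l dvd k" if "e ^ k = 1" for k
    proof (rule ccontr)
      assume "\<not> l dvd k"
      hence "coprime l k" using l prime_imp_coprime by blast
      then obtain u v where "u * k = v * l + 1"
        using \<open>\<not> l dvd k\<close> by (metis bezout_nat coprime_iff_gcd_eq_1 dvd_0_right gcd.commute mult.commute)
      hence "e ^ (k * u) = e ^ (l * v + 1)" by (simp add: mult.commute)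
      hence "e = 1" using that e by (simp add: power_add power_mult)
      thus False using e by simp
    qed
    show ?thesis
    proof (cases "l dvd m")
      case True
      then obtain m' where m': "m = l * m'" by auto
      obtain z where z: "z ^ l = w" using nth_root_exists[of l w] m by auto
      have zm: "z ^ m = w ^ m'" by (simp add: m' power_mult z)
      have "q dvd k" if "z ^ k = 1" for k
      proof -
        have "w ^ k = 1" by (metis z that power_mult mult.commute power_one)
        hence "m dvd k" using primitive_root_dvd w m by blast
        then obtain j where j: "k = m * j" by auto
        have "w ^ (m' * j) = 1" using that by (simp add: j power_mult zm)
        hence "m dvd m' * j" using primitive_root_dvd w m by blast
        hence "l dvd j" using m m' by (simp add: mult.commute)
        thus ?thesis by (auto simp: q j)
      qed
      moreover have "z ^ q = 1" by (simp add: q power_mult z wm)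
      ultimately have "primitive_root q z"
        unfolding primitive_root_def by (meson nat_dvd_not_less)
      thus ?thesis ..
    next
      case False
      hence cop: "coprime l m" using l prime_imp_coprime by blast
      define z where "z = w * e"
      have "q dvd k" if k: "z ^ k = 1" for k
      proof -
        have "(z ^ k) ^ l = 1" "(z ^ k) ^ m = 1" by (simp_all add: k)
        moreover have "(z ^ k) ^ l = w ^ (k * l) * (e ^ l) ^ k"
          by (simp add: z_def power_mult_distrib flip: power_mult) (simp add: mult.commute)
        moreover have "(z ^ k) ^ m = (w ^ m) ^ k * e ^ (k * m)"
          by (simp add: z_def power_mult_distrib flip: power_mult) (simp add: mult.commute)
        ultimately have "w ^ (k * l) = 1" "e ^ (k * m) = 1" by (simp_all add: wm e)
        hence "m dvd k * l" "l dvd k * m" using primitive_root_dvd w m ek by blast+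
        hence "m dvd k" "l dvd k"
          using cop by (simp_all add: coprime_dvd_mult_left_iff coprime_commute)
        thus ?thesis unfolding q using cop by (simp add: divides_mult)
      qed
      moreover have "z ^ q = 1"
      proof -
        have "z ^ q = (w ^ m) ^ l * (e ^ l) ^ m"
          by (simp add: z_def q power_mult_distrib flip: power_mult) (simp add: mult.commute)
        thus ?thesis by (simp add: wm e)
      qed
      ultimately have "primitive_root q z"
        unfolding primitive_root_def by (meson nat_dvd_not_less)
      thus ?thesis ..
    qed
  qed
qed

text \<open>The product of the y - 1/f(zeta^i t) for i = 1, ..., q, a polynomial in y over K((t)).\<close>
definition conj_prod :: "'a::field fls \<Rightarrow> nat \<Rightarrow> 'a fls poly" where
  "conj_prod f q =
     (\<Prod>i=1..q. [:- inverse (fls_compose_fps f (fps_const (zeta q ^ i) * fps_X)), 1:])"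

text \<open>If f has order at most 0, only nonnegative powers of x = t^q occur in the product, and
  the coefficient of x^a y^b is the one of t^(qa) y^b; see \<open>assoc_curve_spec\<close> below.\<close>
definition assoc_curve :: "'a::field fls \<Rightarrow> nat \<Rightarrow> 'a fps fps" where
  "assoc_curve f q =
     Abs_fps (\<lambda>b. Abs_fps (\<lambda>a. fls_nth (coeff (conj_prod f q) b) (int (q * a))))"

lemma coeff_prod_linear_hom:
  fixes h :: "'b::comm_ring_1 \<Rightarrow> 'c::comm_ring_1"
  assumes "\<And>x y. h (x + y) = h x + h y" "\<And>x y. h (x * y) = h x * h y" "h 0 = 0" "h 1 = 1"
  shows "h (coeff (\<Prod>i\<in>A. [:a i, 1:]) b) = coeff (\<Prod>i\<in>A. [:h (a i), 1:]) b"
proof (induction A arbitrary: b rule: infinite_finite_induct)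
  case (insert x A)
  thus ?case by (cases b) (simp_all add: assms)
qed (simp_all add: assms coeff_1 of_bool_def)

lemma assoc_curve_spec:
  fixes f :: "'a::{alg_closed_field, field_char_0} fls"
  assumes "q > 0" "fls_subdegree f \<le> 0"
  shows "fps_to_fls (fps_nth (assoc_curve f q) b oo fps_X ^ q) = coeff (conj_prod f q) b"
proof -
  define z where "z = (zeta q :: 'a)"
  have z: "primitive_root q z"
    unfolding z_def zeta_def using primitive_root_exists[OF assms(1)] by (rule someI_ex)
  hence zq: "z ^ q = 1" by (simp add: primitive_root_def)
  hence z0: "z \<noteq> 0" using assms(1) by (auto simp: power_0_left)
  define G where "G i = - inverse (fls_compose_fps f (fps_const (z ^ i) * fps_X))" for i
  define P where "P = conj_prod f q"
  have P: "P = (\<Prod>i=1..q. [:G i, 1:])"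
    by (simp add: P_def conj_prod_def G_def z_def)
  define s where "s F = fls_compose_fps F (fps_const z * fps_X)" for F :: "'a fls"
  have s_G: "s (G i) = G (Suc i)" for i
  proof -
    have "s (G i) = - inverse (s (fls_compose_fps f (fps_const (z ^ i) * fps_X)))"
      using z0 by (simp add: s_def G_def fls_compose_fps_inverse)
    also have "s (fls_compose_fps f (fps_const (z ^ i) * fps_X)) =
               fls_compose_fps f (fps_const (z ^ Suc i) * fps_X)"
      unfolding s_def using z0
      by (subst fls_compose_fps_assoc)
         (simp_all add: fps_compose_mult_distrib mult_ac flip: fps_const_mult)
    finally show ?thesis by (simp add: G_def)
  qed
  have sP: "s (coeff P b) = coeff P b"
  proof -
    have "s (coeff P b) = coeff (\<Prod>i=1..q. [:s (G i), 1:]) b"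
      unfolding P using z0
      by (intro coeff_prod_linear_hom) (simp_all add: s_def fls_compose_fps_add fls_compose_fps_mult)
    also have "(\<Prod>i=1..q. [:s (G i), 1:]) = (\<Prod>i=1..q. [:G (Suc i), 1:])"
      by (simp add: s_G)
    also have "\<dots> = (\<Prod>i=2..Suc q. [:G i, 1:])"
      by (rule prod.reindex_bij_witness[of _ "\<lambda>i. i - 1" Suc]) auto
    also have "{2..Suc q} = insert (Suc q) ({1..q} - {1})" using assms by auto
    also have "(\<Prod>i\<in>insert (Suc q) ({1..q} - {1}). [:G i, 1:]) =
               [:G (Suc q), 1:] * (\<Prod>i\<in>{1..q} - {1}. [:G i, 1:])"
      by (subst prod.insert) auto
    also have "G (Suc q) = G 1" by (simp add: G_def zq)
    also have "[:G 1, 1:] * (\<Prod>i\<in>{1..q} - {1}. [:G i, 1:]) = P"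
      unfolding P using assms by (intro prod.remove[symmetric]) auto
    finally show ?thesis .
  qed
  have "\<exists>H. G i = fps_to_fls H" for i
  proof -
    have "fls_subdegree (G i) \<ge> 0" using assms z0
      by (cases "f = 0") (simp_all add: G_def)
    thus ?thesis by (metis fls_regpart_to_fls_trivial)
  qed
  then obtain H where H: "\<And>i. G i = fps_to_fls (H i)" by metis
  have "coeff P b = fps_to_fls (coeff (\<Prod>i=1..q. [:H i, 1:]) b)"
    unfolding P H
    by (rule coeff_prod_linear_hom[symmetric]) (simp_all add: fls_times_fps_to_fls)
  then obtain c where c: "coeff P b = fps_to_fls c" by blast
  have c0: "fps_nth c n = 0" if "\<not> q dvd n" for n
  proof (rule ccontr)
    assume "fps_nth c n \<noteq> 0"
    moreover have "fls_nth (s (coeff P b)) (int n) = fls_nth (coeff P b) (int n) * z powi int n"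
      unfolding s_def using z0 by (rule fls_nth_fls_compose_fps_linear)
    ultimately have "z ^ n = 1" unfolding sP by (simp add: c)
    with z assms that show False using primitive_root_dvd by blast
  qed
  have "fps_nth (assoc_curve f q) b oo fps_X ^ q = c"
  proof (rule fps_ext)
    fix n
    have "fps_nth (fps_nth (assoc_curve f q) b oo fps_X ^ q) n =
       (if q dvd n then fps_nth (fps_nth (assoc_curve f q) b) (n div q) else 0)"
      using assms by (simp add: fps_nth_compose_X_power)
    also have "\<dots> = fps_nth c n"
      using c c0 by (auto simp: assoc_curve_def P_def simp flip: of_nat_mult simp del: of_nat_mult)
    finally show "fps_nth (fps_nth (assoc_curve f q) b oo fps_X ^ q) n = fps_nth c n" .
  qed
  thus ?thesis using c by (simp add: P_def)
qed

section \<open>The series attached to the local Fourier transforms\<close>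

text \<open>
  \<open>th\<close> is theta as a power series in t, and \<^term>\<open>fps_inv th\<close> its inverse t(theta) with respect
  to composition. Each predicate relates f, of order -p in t, to the series g in theta
  obtained from any admissible choice of theta.
\<close>

definition uniformizer :: "'a::field fps \<Rightarrow> bool" where
  "uniformizer th \<longleftrightarrow> fps_nth th 0 = 0 \<and> fps_nth th 1 \<noteq> 0"

lemma uniformizer_exists:
  fixes F :: "'a::{alg_closed_field, field_char_0} fls"
  assumes "k > 0" "fls_subdegree F = int k"
  shows "\<exists>th. uniformizer th \<and> fps_to_fls th ^ k = F"
proof -
  define u where "u = fls_base_factor_to_fps F"
  have F0: "F \<noteq> 0" using assms by auto
  hence u0: "fps_nth u 0 \<noteq> 0" by (simp add: u_def)
  obtain c where c: "c ^ k = fps_nth u 0" using nth_root_exists[of k "fps_nth u 0"] assms by auto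
  define v where "v = fps_radical (\<lambda>_ _. c) k u"
  obtain k' where k': "k = Suc k'" using assms by (cases k) auto
  have v: "v ^ k = u"
    unfolding v_def k' using power_radical[of u "\<lambda>_ _. c" k'] c u0 k' by auto
  have "fps_nth v 0 = c" using assms by (simp add: v_def)
  moreover have "c \<noteq> 0" using c u0 assms by (auto simp: power_0_left)
  ultimately have "uniformizer (fps_X * v)" by (simp add: uniformizer_def)
  moreover have "fps_to_fls (fps_X * v) ^ k = F"
  proof -
    have "fps_to_fls (fps_X * v) ^ k = fps_to_fls (fps_X ^ k * u)"
      by (simp add: v power_mult_distrib flip: fps_to_fls_power)
    also have "\<dots> = fls_shift (- int k) (fps_to_fls u)"
      by (simp add: fls_times_fps_to_fls fps_to_fls_power fls_X_power_times_conv_shift)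
    also have "\<dots> = F" unfolding u_def assms(2)[symmetric]
      by (rule fls_conv_base_factor_to_fps_shift_subdegree[symmetric])
    finally show ?thesis .
  qed
  ultimately show ?thesis by blast
qed

definition lft_inf_zero :: "'a::field fls \<Rightarrow> nat \<Rightarrow> nat \<Rightarrow> 'a fls \<Rightarrow> bool" where
  "lft_inf_zero f p q g \<longleftrightarrow>
     (\<exists>th. uniformizer th \<and> fps_to_fls th ^ (q - p) = fls_X ^ q * f \<and>
           g = - fls_compose_fps f (fps_inv th))"

definition lft_zero_inf :: "'a::field fls \<Rightarrow> nat \<Rightarrow> nat \<Rightarrow> 'a fls \<Rightarrow> bool" where
  "lft_zero_inf f p q g \<longleftrightarrow>
     (\<exists>th. uniformizer th \<and> fps_to_fls th ^ (p + q) = - (fls_X ^ q / f) \<and>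
           g = fls_compose_fps f (fps_inv th))"

definition lft_inf_inf :: "'a::field fls \<Rightarrow> nat \<Rightarrow> nat \<Rightarrow> 'a fls \<Rightarrow> bool" where
  "lft_inf_inf f p q g \<longleftrightarrow>
     (\<exists>th. uniformizer th \<and> fps_to_fls th ^ (p - q) = 1 / (fls_X ^ q * f) \<and>
           g = - fls_compose_fps f (fps_inv th))"

section \<open>Transforms of curves\<close>

definition multiplicity2 :: "'a::field fps fps \<Rightarrow> nat" where
  "multiplicity2 C = (LEAST k. \<exists>a b. a + b = k \<and> fps_nth (fps_nth C b) a \<noteq> 0)"

text \<open>C(x y, y): the monomial x^a y^b is sent to x^a y^(a+b).\<close>
definition subst_xy_y :: "'a::field fps fps \<Rightarrow> 'a fps fps" where
  "subst_xy_y C =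
     Abs_fps (\<lambda>j. Abs_fps (\<lambda>i. if i \<le> j then fps_nth (fps_nth C (j - i)) i else 0))"

definition sigma2 :: "'a::field fps fps \<Rightarrow> 'a fps fps" where
  "sigma2 C = fps_shift (multiplicity2 C) (subst_xy_y C)"

lemma sigma2_spec: "fps_X ^ multiplicity2 C * sigma2 C = subst_xy_y C"
proof -
  have "fps_nth (subst_xy_y C) j = 0" if "j < multiplicity2 C" for j
  proof (rule fps_ext)
    fix i
    have "fps_nth (fps_nth C (j - i)) i = 0" if "i \<le> j"
    proof (rule ccontr)
      assume "fps_nth (fps_nth C (j - i)) i \<noteq> 0"
      hence "multiplicity2 C \<le> j"
        unfolding multiplicity2_def using that by (intro Least_le exI[of _ i] exI[of _ "j - i"]) auto
      thus False using \<open>j < multiplicity2 C\<close> by simp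
    qed
    thus "fps_nth (fps_nth (subst_xy_y C) j) i = fps_nth 0 i" by (simp add: subst_xy_y_def)
  qed
  thus ?thesis
    by (intro fps_ext) (auto simp: sigma2_def fps_X_power_mult_nth)
qed

text \<open>A parametrization is primitive if it does not factor through a substitution of order
  greater than one.\<close>
definition good_param :: "'a::field fps fps \<Rightarrow> 'a fps \<Rightarrow> 'a fps \<Rightarrow> bool" where
  "good_param C X Y \<longleftrightarrow>
     fps_nth X 0 = 0 \<and> fps_nth Y 0 = 0 \<and> eval_at C X Y = 0 \<and>
     (\<forall>X' Y' h. fps_nth h 0 = 0 \<and> X = X' oo h \<and> Y = Y' oo h \<longrightarrow> fps_nth h 1 \<noteq> 0)"

text \<open>The germ is the set of all power series defining it. It is empty if \<open>C\<close> has no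
  parametrization of the required form with m < n (for m = n the transformed branch does not
  pass through the origin).\<close>
definition sigma3 :: "'a::field fps fps \<Rightarrow> 'a fps fps set" where
  "sigma3 C = {D. irreducible C \<and> irreducible D \<and>
     (\<exists>m n \<alpha>. fps_nth \<alpha> 0 \<noteq> 0 \<and> m \<le> n \<and>
        good_param C (fps_X ^ m * \<alpha>) (fps_X ^ n) \<and>
        good_param D (fps_X ^ (n - m) * inverse \<alpha>) (fps_X ^ n))}"

end

theory Submission
  imports Defs
begin

text \<open>
  Put F = 1/f. The curve of f is the minimal equation of the branch (t^q, F(t)): a series D(x,y)
  with D(t^q, F(t)) = 0 also vanishes at all conjugates of F, which are pairwise distinct since no
  nontrivial rotation t \<mapsto> w t with w^q = 1 fixes F, hence D is a multiple of the curve. In terms of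
  branches the theorem is immediate: \<open>\<sigma>\<^sub>2\<close> sends (X, Y) to (X/Y, Y), \<open>\<sigma>\<^sub>3\<close> sends it to (Y/X, Y), and
  the equation for theta says precisely that the new first coordinate is (up to sign)
  the required power of theta. Rotations fixing the transformed branch correspond, through the
  change of parameter, to rotations fixing F, so primitivity is inherited. For \<open>\<sigma>\<^sub>2\<close> it remains to see
  that the quotient of the two equations is a unit, which follows by comparing them at x = 0:
  both reduce to the same power of y, as the multiplicity of the curve is the order p of F.
\<close>

section \<open>Evaluation of power series in two variables\<close>

text \<open>Acts on x alone. The choice \<open>h = fps_X ^ q\<close> passes from x to the parameter
  t, rotations of t permute the conjugates, and \<open>h = 0\<close> restricts to the line x =
  0.\<close>

definition coeff_subst :: "'a::field fps \<Rightarrow> 'a fps fps \<Rightarrow> 'a fps fps" where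
  "coeff_subst h E = Abs_fps (\<lambda>b. fps_nth E b oo h)"

text \<open>Isolates the substitution for y in \<open>eval_at\<close>, so that it can be studied as
  reduction modulo y - Y over the power series in the parameter.\<close>

definition fps_eval :: "'a::field fps fps \<Rightarrow> 'a fps \<Rightarrow> 'a fps" where
  "fps_eval E Y = Abs_fps (\<lambda>n. \<Sum>b\<le>n. fps_nth (fps_nth E b * Y ^ b) n)"

lemma eval_at_conv_fps_eval: "eval_at C X Y = fps_eval (coeff_subst X C) Y"
  by (simp add: eval_at_def fps_eval_def coeff_subst_def)

lemma coeff_subst_nth [simp]: "fps_nth (coeff_subst h E) b = fps_nth E b oo h"
  by (simp add: coeff_subst_def)

lemma coeff_subst_add: "coeff_subst h (D + E) = coeff_subst h D + coeff_subst h E"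
  by (simp add: fps_eq_iff[of "coeff_subst h (D + E)"] fps_compose_add_distrib)

lemma coeff_subst_diff: "coeff_subst h (D - E) = coeff_subst h D - coeff_subst h E"
  by (simp add: fps_eq_iff[of "coeff_subst h (D - E)"] fps_compose_sub_distrib)

lemma coeff_subst_uminus: "coeff_subst h (- E) = - coeff_subst h E"
  by (rule fps_ext) (simp add: fps_compose_uminus)

lemma coeff_subst_const [simp]: "coeff_subst h (fps_const c) = fps_const (c oo h)"
  by (rule fps_ext) simp

lemma coeff_subst_X [simp]: "coeff_subst h fps_X = fps_X"
  by (rule fps_ext) simp

lemma coeff_subst_1 [simp]: "coeff_subst h 1 = 1"
  by (rule fps_ext) simp

lemma coeff_subst_0 [simp]: "coeff_subst h 0 = 0"
  by (rule fps_ext) simp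

lemma coeff_subst_mult:
  assumes "fps_nth h 0 = 0"
  shows "coeff_subst h (D * E) = coeff_subst h D * coeff_subst h E"
  by (rule fps_ext) (simp add: fps_mult_nth fps_compose_sum_distrib fps_compose_mult_distrib[OF assms])

lemma coeff_subst_prod:
  assumes "fps_nth h 0 = 0"
  shows "coeff_subst h (prod G A) = (\<Prod>i\<in>A. coeff_subst h (G i))"
  by (induction A rule: infinite_finite_induct) (simp_all add: coeff_subst_mult[OF assms])

lemma coeff_subst_coeff_subst:
  assumes "fps_nth h 0 = 0" "fps_nth k 0 = 0"
  shows "coeff_subst k (coeff_subst h E) = coeff_subst (h oo k) E"
  by (rule fps_ext) (simp add: fps_compose_assoc[OF assms(2,1)])

lemma coeff_subst_fps_X [simp]: "coeff_subst fps_X E = E"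
  by (rule fps_ext) simp

text \<open>Allows identities in x to be checked after x = t^q: composition with a nonzero series
  without constant term kills only 0.\<close>

lemma coeff_subst_inject:
  assumes "fps_nth h 0 = 0" "h \<noteq> 0"
  shows "coeff_subst h D = coeff_subst h E \<longleftrightarrow> D = E"
proof
  assume "coeff_subst h D = coeff_subst h E"
  hence "(fps_nth D b - fps_nth E b) oo h = 0" for b
    by (metis coeff_subst_nth fps_compose_sub_distrib eq_iff_diff_eq_0)
  thus "D = E"
    using assms by (intro fps_ext) (simp add: fps_compose_eq_0_iff)
qed simp

lemma nth_0_nth_coeff_subst_0: "fps_nth (fps_nth E b) 0 = fps_nth (fps_nth (coeff_subst 0 E) b) 0"
  by simp

section \<open>Evaluation in y and division by linear factors\<close>

lemma fps_nth_mult_power_eq_0: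
  assumes "fps_nth Y 0 = 0" "n < b"
  shows "fps_nth (c * Y ^ b) n = (0::'a::field)"
  unfolding fps_mult_nth
proof (intro sum.neutral ballI)
  fix i assume "i \<in> {0..n}"
  hence "fps_nth (Y ^ b) (n - i) = 0"
    using startsby_zero_power_prefix[OF assms(1)] assms(2) by auto
  thus "fps_nth c i * fps_nth (Y ^ b) (n - i) = 0" by simp
qed

lemma fps_eval_nth:
  assumes "fps_nth Y 0 = 0" "n \<le> N"
  shows "fps_nth (fps_eval E Y) n = fps_nth (\<Sum>b\<le>N. fps_nth E b * Y ^ b) n"
proof -
  have "(\<Sum>b\<le>n. fps_nth (fps_nth E b * Y ^ b) n) = (\<Sum>b\<le>N. fps_nth (fps_nth E b * Y ^ b) n)"
    using assms by (intro sum.mono_neutral_left) (auto intro!: fps_nth_mult_power_eq_0)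
  thus ?thesis by (simp add: fps_eval_def fps_sum_nth)
qed

lemma fps_eval_add: "fps_eval (D + E) Y = fps_eval D Y + fps_eval E Y"
  by (rule fps_ext) (simp add: fps_eval_def sum.distrib ring_distribs)

lemma fps_eval_const [simp]: "fps_eval (fps_const c) Y = c"
proof (rule fps_ext)
  fix n
  have "fps_nth (fps_eval (fps_const c) Y) n = (\<Sum>b\<le>n. if b = 0 then fps_nth c n else 0)"
    unfolding fps_eval_def fps_nth_Abs_fps by (rule sum.cong) auto
  thus "fps_nth (fps_eval (fps_const c) Y) n = fps_nth c n" by simp
qed

text \<open>The partial sums telescope: up to index n only -Q_n Y^(n+1) survives, and its order
  exceeds n.\<close>

lemma fps_eval_root:
  assumes "fps_nth Y 0 = 0"
  shows "fps_eval ((fps_X - fps_const Y) * Q) Y = 0"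
proof (rule fps_ext)
  fix n
  have "(\<Sum>b\<le>n. fps_nth ((fps_X - fps_const Y) * Q) b * Y ^ b) = - (fps_nth Q n * Y ^ Suc n)"
    by (induction n) (simp_all add: algebra_simps)
  hence "fps_nth (fps_eval ((fps_X - fps_const Y) * Q) Y) n = - fps_nth (fps_nth Q n * Y ^ Suc n) n"
    by (subst fps_eval_nth[OF assms order_refl]) (simp del: power_Suc)
  thus "fps_nth (fps_eval ((fps_X - fps_const Y) * Q) Y) n = fps_nth 0 n"
    using fps_nth_mult_power_eq_0[OF assms lessI, of "fps_nth Q n"] by simp
qed

lemma fps_eval_shift:
  assumes "fps_nth Y 0 = 0"
  shows "fps_eval E Y = fps_nth E 0 + Y * fps_eval (fps_shift 1 E) Y"
proof (rule fps_ext)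
  fix n
  have "fps_nth (Y * fps_eval (fps_shift 1 E) Y) n =
          fps_nth (Y * (\<Sum>b\<le>n. fps_nth (fps_shift 1 E) b * Y ^ b)) n"
    unfolding fps_mult_nth by (intro sum.cong refl) (simp add: fps_eval_nth[OF assms, of _ n])
  also have "Y * (\<Sum>b\<le>n. fps_nth (fps_shift 1 E) b * Y ^ b) = (\<Sum>b\<le>n. fps_nth E (Suc b) * Y ^ Suc b)"
    by (simp add: sum_distrib_left mult_ac)
  finally show "fps_nth (fps_eval E Y) n =
                  fps_nth (fps_nth E 0 + Y * fps_eval (fps_shift 1 E) Y) n"
    using fps_eval_nth[OF assms, of n "Suc n" E]
    by (simp add: sum.atMost_Suc_shift del: sum.atMost_Suc power_Suc)
qed

text \<open>Division with remainder by y - Y. Horner's scheme yields the quotient: its coefficient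
  at y^b is the value at Y of E shifted by b + 1.\<close>

lemma fps_eval_remainder:
  assumes "fps_nth Y 0 = 0"
  obtains Q where "E = fps_const (fps_eval E Y) + (fps_X - fps_const Y) * Q"
proof
  define Q where "Q = Abs_fps (\<lambda>b. fps_eval (fps_shift (Suc b) E) Y)"
  have "fps_nth E b = fps_nth (fps_const (fps_eval E Y) + (fps_X - fps_const Y) * Q) b" for b
    using fps_eval_shift[OF assms, of "fps_shift b E"] fps_shift_fps_shift[of 1 b E]
    by (cases b) (simp_all add: Q_def algebra_simps)
  thus "E = fps_const (fps_eval E Y) + (fps_X - fps_const Y) * Q"
    by (intro fps_ext[of E]) 
qed

text \<open>Every series is congruent to its value modulo y - Y, and multiples of y - Y evaluate to
  0, so no convolution of infinite sums is needed.\<close>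

lemma fps_eval_mult:
  assumes "fps_nth Y 0 = 0"
  shows "fps_eval (D * E) Y = fps_eval D Y * fps_eval E Y"
proof -
  let ?l = "fps_X - fps_const Y"
  obtain P Q where P: "D = fps_const (fps_eval D Y) + ?l * P"
    and Q: "E = fps_const (fps_eval E Y) + ?l * Q"
    using fps_eval_remainder[OF assms] by metis
  define d e where "d = fps_eval D Y" and "e = fps_eval E Y"
  have "D * E = (fps_const d + ?l * P) * (fps_const e + ?l * Q)"
    using P Q by (simp add: d_def e_def)
  also have "\<dots> = fps_const (d * e) + ?l * (P * fps_const e + fps_const d * Q + ?l * P * Q)"
    by (simp add: algebra_simps flip: fps_const_mult)
  finally show ?thesis
    by (simp only: fps_eval_add fps_eval_root[OF assms] fps_eval_const d_def e_def) simp
qed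

lemma fps_eval_prod:
  assumes "fps_nth Y 0 = 0"
  shows "fps_eval (prod G A) Y = (\<Prod>i\<in>A. fps_eval (G i) Y)"
proof -
  have [simp]: "fps_eval 1 Y = 1" using fps_eval_const[of 1 Y] by simp
  show ?thesis
    by (induction A rule: infinite_finite_induct) (simp_all add: fps_eval_mult[OF assms])
qed

text \<open>A change of parameter carries a division by y - Y to a division by y - Y(h), hence
  remainder to remainder.\<close>

lemma fps_eval_compose:
  assumes "fps_nth Y 0 = 0" "fps_nth h 0 = 0"
  shows "fps_eval (coeff_subst h E) (Y oo h) = fps_eval E Y oo h"
proof -
  obtain Q where Q: "E = fps_const (fps_eval E Y) + (fps_X - fps_const Y) * Q"
    using fps_eval_remainder[OF assms(1)] by blast
  have "coeff_subst h E = fps_const (fps_eval E Y oo h) + (fps_X - fps_const (Y oo h)) * coeff_subst h Q"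
    by (subst Q) (simp add: coeff_subst_add coeff_subst_mult[OF assms(2)] coeff_subst_diff)
  thus ?thesis
    using assms by (simp add: fps_eval_add fps_eval_root)
qed

lemma fps_eval_X_minus:
  assumes "fps_nth Y 0 = 0"
  shows "fps_eval (fps_X - fps_const Z) Y = Y - Z"
proof -
  have "fps_eval (fps_const (Y - Z) + (fps_X - fps_const Y) * 1) Y = Y - Z"
    using assms by (simp only: fps_eval_add fps_eval_root fps_eval_const) simp
  moreover have "fps_const (Y - Z) + (fps_X - fps_const Y) * 1 = fps_X - fps_const Z"
    by (simp flip: fps_const_sub)
  ultimately show ?thesis by argo
qed

lemma fps_eval_X: "fps_nth Y 0 = 0 \<Longrightarrow> fps_eval fps_X Y = Y"
  using fps_eval_X_minus[of Y 0] by simp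

text \<open>After one linear factor is divided out, the quotient still vanishes at the other roots,
  because the difference of two distinct roots can be cancelled.\<close>

lemma fps_eval_distinct_roots:
  assumes "finite A" "inj_on G A" "\<And>i. i \<in> A \<Longrightarrow> fps_nth (G i) 0 = 0"
    and "\<And>i. i \<in> A \<Longrightarrow> fps_eval E (G i) = 0"
  shows "(\<Prod>i\<in>A. fps_X - fps_const (G i)) dvd E"
  using assms
proof (induction A arbitrary: E)
  case (insert j A)
  obtain Q where Q: "E = fps_const (fps_eval E (G j)) + (fps_X - fps_const (G j)) * Q"
    using fps_eval_remainder insert.prems by (metis insertI1)
  hence E: "E = (fps_X - fps_const (G j)) * Q" using insert.prems by simp
  have "fps_eval Q (G i) = 0" if i: "i \<in> A" for i
  proof -
    have "(G i - G j) * fps_eval Q (G i) = fps_eval E (G i)"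
      using insert.prems i by (simp add: E fps_eval_mult fps_eval_X_minus)
    moreover have "G i \<noteq> G j"
      using insert.prems(1) insert.hyps(2) i by (auto simp: inj_on_def)
    ultimately show ?thesis using insert.prems i by simp
  qed
  hence "(\<Prod>i\<in>A. fps_X - fps_const (G i)) dvd Q"
    using insert by (auto intro!: insert.IH)
  thus ?case using insert.hyps by (simp add: E)
qed simp

section \<open>Evaluation on a pair of power series\<close>

lemma eval_at_mult:
  assumes "fps_nth X 0 = 0" "fps_nth Y 0 = 0"
  shows "eval_at (C * D) X Y = eval_at C X Y * eval_at D X Y"
  using assms by (simp add: eval_at_conv_fps_eval coeff_subst_mult fps_eval_mult)

lemma eval_at_X_power:
  assumes "fps_nth X 0 = 0" "fps_nth Y 0 = 0"
  shows "eval_at (fps_X ^ k) X Y = Y ^ k"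
proof (induction k)
  case 0
  show ?case using fps_eval_const[of 1 Y] by (simp add: eval_at_conv_fps_eval)
next
  case (Suc k)
  have "eval_at fps_X X Y = Y" using assms by (simp add: eval_at_conv_fps_eval fps_eval_X)
  thus ?case using Suc assms by (simp add: eval_at_mult)
qed

lemma eval_at_compose:
  assumes "fps_nth X 0 = 0" "fps_nth Y 0 = 0" "fps_nth h 0 = 0"
  shows "eval_at C (X oo h) (Y oo h) = eval_at C X Y oo h"
  using assms by (simp add: eval_at_conv_fps_eval fps_eval_compose flip: coeff_subst_coeff_subst)

lemma eval_at_compose_eq_0_iff:
  assumes "fps_nth X 0 = 0" "fps_nth Y 0 = 0" "fps_nth h 0 = 0" "h \<noteq> 0"
  shows "eval_at C (X oo h) (Y oo h) = 0 \<longleftrightarrow> eval_at C X Y = 0"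
  using assms by (simp add: eval_at_compose fps_compose_eq_0_iff)

text \<open>Since X^a Y^b has order at least a + b, a finite triangle of monomials determines each
  coefficient. This form can be reindexed monomial by monomial.\<close>

lemma eval_at_nth:
  assumes X: "fps_nth X 0 = 0" and Y: "fps_nth Y 0 = 0" and n: "n \<le> N"
  shows "fps_nth (eval_at C X Y) n =
           (\<Sum>b\<le>N. \<Sum>a\<le>N - b. fps_nth (fps_nth C b) a * fps_nth (X ^ a * Y ^ b) n)"
proof -
  have "fps_nth ((fps_nth C b oo X) * Y ^ b) n =
        (\<Sum>a\<le>N - b. fps_nth (fps_nth C b) a * fps_nth (X ^ a * Y ^ b) n)" if "b \<le> N" for b
  proof -
    define c where "c = (\<Sum>a\<le>N - b. fps_const (fps_nth (fps_nth C b) a) * X ^ a)"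
    have 1: "fps_nth (fps_nth C b oo X) k = fps_nth c k" if "k \<le> N - b" for k
    proof -
      have "fps_nth (fps_nth C b oo X) k = (\<Sum>a\<in>{0..k}. fps_nth (fps_nth C b) a * fps_nth (X ^ a) k)"
        by (simp add: fps_compose_nth)
      also have "\<dots> = (\<Sum>a\<le>N - b. fps_nth (fps_nth C b) a * fps_nth (X ^ a) k)"
        using that startsby_zero_power_prefix[OF X] by (intro sum.mono_neutral_left) auto
      finally show ?thesis by (simp add: c_def fps_sum_nth)
    qed
    \<comment> \<open>If n - k < b, the power of Y contributes nothing; otherwise k \<le> N - b and
      the truncation \<open>c\<close> is exact.\<close>
    have "fps_nth (fps_nth C b oo X) k * fps_nth (Y ^ b) (n - k) =
          fps_nth c k * fps_nth (Y ^ b) (n - k)" if "k \<le> n" for k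
      using 1[of k] startsby_zero_power_prefix[OF Y, of b] n that
      by (cases "n - k < b") auto
    hence "fps_nth ((fps_nth C b oo X) * Y ^ b) n = fps_nth (c * Y ^ b) n"
      unfolding fps_mult_nth by (intro sum.cong) auto
    also have "c * Y ^ b = (\<Sum>a\<le>N - b. fps_const (fps_nth (fps_nth C b) a) * (X ^ a * Y ^ b))"
      by (simp add: c_def sum_distrib_right mult.assoc)
    finally show ?thesis by (simp add: fps_sum_nth)
  qed
  hence "(\<Sum>b\<le>N. fps_nth ((fps_nth C b oo X) * Y ^ b) n) =
      (\<Sum>b\<le>N. \<Sum>a\<le>N - b. fps_nth (fps_nth C b) a * fps_nth (X ^ a * Y ^ b) n)"
    by simp
  thus ?thesis
    using fps_eval_nth[OF Y n, of "coeff_subst X C"]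
    by (simp add: eval_at_conv_fps_eval fps_sum_nth)
qed

lemma eval_at_subst_xy_y:
  assumes X: "fps_nth X 0 = 0" and Y: "fps_nth Y 0 = 0"
  shows "eval_at (subst_xy_y C) X Y = eval_at C (X * Y) Y"
proof (rule fps_ext)
  fix n
  let ?t = "\<lambda>(j, i). fps_nth (fps_nth (subst_xy_y C) j) i * fps_nth (X ^ i * Y ^ j) n"
  have 0: "i \<le> n - j" if "fps_nth (X ^ i * Y ^ j) n \<noteq> 0" for i j
  proof -
    have "X = fps_X * fps_shift 1 X" "Y = fps_X * fps_shift 1 Y"
      using X Y by (simp_all add: fps_eq_iff)
    then obtain X' Y' where "X = fps_X * X'" "Y = fps_X * Y'" by blast
    hence "X ^ i * Y ^ j = fps_X ^ (i + j) * (X' ^ i * Y' ^ j)"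
      by (simp add: power_mult_distrib power_add mult_ac)
    thus ?thesis using that by (auto simp: fps_X_power_mult_nth split: if_splits)
  qed
  have XY: "(X * Y) ^ a * Y ^ (j - a) = X ^ a * Y ^ j" if "a \<le> j" for a j
    using that power_add[of Y a "j - a"] by (simp add: power_mult_distrib mult_ac)
  have "fps_nth (eval_at (subst_xy_y C) X Y) n = (\<Sum>(j, i)\<in>(SIGMA j:{..n}. {..n - j}). ?t (j, i))"
    by (subst eval_at_nth[OF assms order_refl]) (simp add: sum.Sigma)
  \<comment> \<open>Terms with i > j vanish by definition of \<open>subst_xy_y\<close>, and terms
    with i + j > n by the order estimate. The remaining range matches the monomials x^a y^b through
    j = a + b, i = a.\<close>
  also have "\<dots> = (\<Sum>z\<in>(SIGMA j:{..n}. {..j}). ?t z)"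
    by (rule sum.mono_neutral_cong) (auto simp: subst_xy_y_def split: if_splits dest: 0)
  also have "\<dots> = (\<Sum>(b, a)\<in>(SIGMA b:{..n}. {..n - b}).
       fps_nth (fps_nth C b) a * fps_nth ((X * Y) ^ a * Y ^ b) n)"
    by (rule sum.reindex_bij_witness[of _ "\<lambda>(b, a). (a + b, a)" "\<lambda>(j, i). (j - i, i)"])
       (auto simp: subst_xy_y_def XY)
  also have "\<dots> = fps_nth (eval_at C (X * Y) Y) n"
    using X Y by (subst eval_at_nth[of _ _ n n]) (simp_all add: sum.Sigma)
  finally show "fps_nth (eval_at (subst_xy_y C) X Y) n = fps_nth (eval_at C (X * Y) Y) n" .
qed

section \<open>Rotations of the parameter\<close>

lemma primitive_root_zeta:
  "q > 0 \<Longrightarrow> primitive_root q (zeta q :: 'a::{alg_closed_field, field_char_0})"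
  unfolding zeta_def using primitive_root_exists by (rule someI_ex)

lemma primitive_root_nonzero: "primitive_root q z \<Longrightarrow> q > 0 \<Longrightarrow> z \<noteq> (0::'a::field)"
  by (auto simp: primitive_root_def power_0_left)

lemma inj_on_primitive_root_power:
  assumes "primitive_root q (z::'a::field)"
  shows "inj_on (\<lambda>i. z ^ i) {1..q}"
proof (cases "q = 0")
  case False
  hence z: "z \<noteq> 0" using primitive_root_nonzero assms by blast
  have *: "i = j" if "z ^ i = z ^ j" "i \<le> j" "1 \<le> i" "j \<le> q" for i j
  proof -
    have "z ^ (j - i) = 1" using that z by (simp add: power_diff)
    hence "\<not> (0 < j - i \<and> j - i < q)" using assms by (auto simp: primitive_root_def)
    thus ?thesis using that by auto
  qed
  show ?thesis
  proof (rule inj_onI)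
    fix i j assume "i \<in> {1..q}" "j \<in> {1..q}" "z ^ i = z ^ j"
    thus "i = j" using *[of i j] *[of j i] by (cases "i \<le> j") auto
  qed
qed simp

lemma exists_primitive_root_order:
  assumes "z ^ q = (1::'a::field)" "q > 0"
  obtains d where "d > 0" "d dvd q" "primitive_root d z"
proof -
  define d where "d = (LEAST k. 0 < k \<and> z ^ k = 1)"
  have d: "0 < d \<and> z ^ d = 1"
    unfolding d_def using assms by (intro LeastI[of "\<lambda>k. 0 < k \<and> z ^ k = 1" q]) auto
  hence prim: "primitive_root d z"
    unfolding primitive_root_def d_def by (metis (mono_tags, lifting) not_less_Least)
  show ?thesis
    using that d prim primitive_root_dvd assms by blast
qed

abbreviation fps_rotate :: "'a::field \<Rightarrow> 'a fps \<Rightarrow> 'a fps" where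
  "fps_rotate w F \<equiv> F oo (fps_const w * fps_X)"

text \<open>Primitivity of the parametrization (t^q, F) in terms of symmetries: the rotations with
  w^q = 1 are those that fix the first coordinate.\<close>

definition trivial_stabilizer :: "nat \<Rightarrow> 'a::field fps \<Rightarrow> bool" where
  "trivial_stabilizer q F \<longleftrightarrow> (\<forall>w. w ^ q = 1 \<and> fps_rotate w F = F \<longrightarrow> w = 1)"

lemma fps_rotate_rotate: "fps_rotate v (fps_rotate w F) = fps_rotate (v * w) F"
  by (rule fps_ext) (simp add: fps_compose_linear power_mult_distrib del: fps_const_mult)

lemma fps_rotate_X_power:
  "w ^ q = 1 \<Longrightarrow> fps_rotate w (fps_X ^ q) = fps_X ^ q"
  by (simp add: fps_eq_iff fps_compose_linear fps_X_power_nth)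

text \<open>If two conjugates agree, rotating one of them back gives a q-th root of unity that fixes
  F.\<close>

lemma trivial_stabilizer_inj_on:
  fixes F :: "'a::{alg_closed_field, field_char_0} fps"
  assumes "trivial_stabilizer q F" "q > 0"
  shows "inj_on (\<lambda>i. fps_rotate (zeta q ^ i) F) {1..q}"
proof (rule inj_onI)
  define z :: 'a where "z = zeta q"
  have z: "primitive_root q z" using primitive_root_zeta assms by (simp add: z_def)
  have z0: "z \<noteq> 0" using primitive_root_nonzero[OF z assms(2)] .
  fix i j assume ij: "i \<in> {1..q}" "j \<in> {1..q}"
    and "fps_rotate (zeta q ^ i) F = fps_rotate (zeta q ^ j) F"
  hence "fps_rotate (inverse (z ^ j)) (fps_rotate (z ^ i) F) =
         fps_rotate (inverse (z ^ j)) (fps_rotate (z ^ j) F)"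
    by (simp add: z_def)
  hence "fps_rotate (inverse (z ^ j) * z ^ i) F = F"
    using z0 by (simp add: fps_rotate_rotate)
  moreover have "(inverse (z ^ j) * z ^ i) ^ q = 1"
  proof -
    have "(inverse (z ^ j) * z ^ i) ^ q = inverse ((z ^ q) ^ j) * (z ^ q) ^ i"
      by (simp add: power_mult_distrib power_inverse power_mult[symmetric] mult.commute)
    thus ?thesis using z by (simp add: primitive_root_def)
  qed
  ultimately have "inverse (z ^ j) * z ^ i = 1"
    using assms(1) by (auto simp: trivial_stabilizer_def)
  hence "z ^ i = z ^ j" using z0 by (simp add: field_simps)
  thus "i = j"
    using inj_onD[OF inj_on_primitive_root_power[OF z]] ij by blast
qed

text \<open>Suppose w has order d and fixes F, hence f. Then f has only exponents divisible by d and
  lies in the field of the (q/d)-th root of x, which the class of f forbids unless d = 1.\<close>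

lemma trivial_stabilizer_of_R_o:
  fixes f :: "'a::field_char_0 fls"
  assumes "R_class q f \<in> R_o q" "q > 0" "inverse f = fps_to_fls F"
  shows "trivial_stabilizer q F"
  unfolding trivial_stabilizer_def
proof (intro allI impI, elim conjE)
  fix w assume w: "w ^ q = 1" "fps_rotate w F = F"
  have w0: "w \<noteq> 0" using w assms(2) by (auto simp: power_0_left)
  obtain d where d: "d > 0" "d dvd q" "primitive_root d w"
    using exists_primitive_root_order[OF w(1) assms(2)] .
  then obtain r where r: "q = d * r" by auto
  have "fls_compose_fps (inverse f) (fps_const w * fps_X) = inverse f"
    using w w0 by (simp add: assms(3))
  hence f: "fls_compose_fps f (fps_const w * fps_X) = f"
    using w0 by (simp add: fls_compose_fps_inverse)
  have "int q dvd n * int r" if "fls_nth f n \<noteq> 0" for n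
  proof -
    have "fls_nth f n = fls_nth f n * w powi n"
      using fls_nth_fls_compose_fps_linear[OF w0, of f n] f by simp
    hence "w powi n = 1" using that by simp
    hence "w ^ nat \<bar>n\<bar> = 1"
      by (cases "n \<ge> 0") (auto simp: power_int_def power_inverse)
    hence "d dvd nat \<bar>n\<bar>" using d primitive_root_dvd by blast
    hence "int d dvd n" by (simp add: int_dvd_int_iff[symmetric])
    thus ?thesis by (simp add: r)
  qed
  hence "f \<in> in_root_field q r" by (simp add: in_root_field_def)
  hence "\<not> (0 < r \<and> r < q)" using assms(1) by (auto simp: R_o_def)
  hence "d = 1" using r d assms(2) by (cases "d = 1") auto
  thus "w = 1" using d by (simp add: primitive_root_def)
qed

section \<open>The equation of a branch\<close>

text \<open>As 1/f has no negative exponents, the factors over Laurent series come from factors over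
  power series, and taking coefficients commutes with the embedding. Later arguments see the curve
  only through this product.\<close>

lemma coeff_subst_assoc_curve:
  fixes f :: "'a::{alg_closed_field, field_char_0} fls"
  assumes q: "q > 0" and f: "fls_subdegree f \<le> 0" and F: "inverse f = fps_to_fls F"
  shows "coeff_subst (fps_X ^ q) (assoc_curve f q) =
           (\<Prod>i=1..q. fps_X - fps_const (fps_rotate (zeta q ^ i) F))"
proof (rule fps_ext)
  fix b
  have z0: "zeta q \<noteq> (0::'a)" using primitive_root_nonzero[OF primitive_root_zeta[OF q] q] .
  define P where "P = (\<Prod>i=1..q. [:- fps_rotate (zeta q ^ i) F, 1:])"
  have "inverse (fls_compose_fps f (fps_const (zeta q ^ i) * fps_X)) =
        fps_to_fls (fps_rotate (zeta q ^ i) F)" for i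
    using z0 by (simp add: F flip: fls_compose_fps_inverse)
  hence "coeff (conj_prod f q) b = coeff (\<Prod>i=1..q. [:fps_to_fls (- fps_rotate (zeta q ^ i) F), 1:]) b"
    by (simp add: conj_prod_def)
  also have "\<dots> = fps_to_fls (coeff P b)"
    unfolding P_def by (rule coeff_prod_linear_hom[symmetric]) (simp_all add: fls_times_fps_to_fls)
  finally have "fps_nth (assoc_curve f q) b oo fps_X ^ q = coeff P b"
    using assoc_curve_spec[OF q f, of b] by simp
  also have "\<dots> = fps_nth (fps_of_poly P) b" by simp
  also have "fps_of_poly P = (\<Prod>i=1..q. fps_X - fps_const (fps_rotate (zeta q ^ i) F))"
    by (simp add: P_def fps_of_poly_prod fps_of_poly_pCons flip: fps_const_neg)
  finally show "fps_nth (coeff_subst (fps_X ^ q) (assoc_curve f q)) b =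
    fps_nth (\<Prod>i=1..q. fps_X - fps_const (fps_rotate (zeta q ^ i) F)) b" by simp
qed

text \<open>Abstracts from f so that the same results serve the curves of f, g and -g. The vanishing
  of F at 0 says that the branch passes through the origin.\<close>

locale branch =
  fixes F :: "'a::{alg_closed_field, field_char_0} fps" and q :: nat and C :: "'a fps fps"
  assumes q_pos: "q > 0"
    and F_0: "fps_nth F 0 = 0"
    and stab: "trivial_stabilizer q F"
    and curve: "coeff_subst (fps_X ^ q) C = (\<Prod>i=1..q. fps_X - fps_const (fps_rotate (zeta q ^ i) F))"
begin

lemma X_power_0: "fps_nth (fps_X ^ q) 0 = 0"
  using q_pos by simp

text \<open>The factor with index i = q is y - F itself, because
  \<open>zeta q ^ q = 1\<close>.\<close>

lemma eval_at_curve: "eval_at C (fps_X ^ q) F = 0"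
proof -
  have "fps_rotate (zeta q ^ q) F = F"
    using primitive_root_zeta[OF q_pos, where ?'a = 'a] by (simp add: primitive_root_def)
  thus ?thesis
    using q_pos F_0 by (auto simp: eval_at_conv_fps_eval curve fps_eval_prod fps_eval_X_minus prod_zero_iff
      intro!: bexI[of _ q])
qed

text \<open>Since D(t^q, y) is invariant under t \<mapsto> \<zeta> t, it vanishes at all q conjugates of F. The
  quotient by the product of the linear factors is invariant too, so it is a series in x = t^q.\<close>
lemma curve_dvd_iff: "C dvd D \<longleftrightarrow> eval_at D (fps_X ^ q) F = 0"
proof
  assume "C dvd D"
  thus "eval_at D (fps_X ^ q) F = 0"
    using eval_at_mult[OF X_power_0 F_0] eval_at_curve by (auto elim!: dvdE)
next
  assume D: "eval_at D (fps_X ^ q) F = 0"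
  define E where "E = coeff_subst (fps_X ^ q) D"
  define G where "G i = fps_rotate (zeta q ^ i) F" for i
  define z :: 'a where "z = zeta q"
  have z: "primitive_root q z" using primitive_root_zeta q_pos by (simp add: z_def)
  have z0: "z \<noteq> 0" using primitive_root_nonzero[OF z q_pos] .
  have zq: "z ^ q = 1" using z by (simp add: primitive_root_def)
  have rot: "coeff_subst (fps_const w * fps_X) (coeff_subst (fps_X ^ q) A) = coeff_subst (fps_X ^ q) A"
    if "w ^ q = 1" for w and A :: "'a fps fps"
    using that q_pos by (subst coeff_subst_coeff_subst) (simp_all add: fps_rotate_X_power)
  have "fps_eval E (G i) = 0" for i
  proof -
    have "(z ^ i) ^ q = 1" using zq by (metis mult.commute power_mult power_one)
    hence "fps_eval E (G i) = fps_rotate (z ^ i) (fps_eval E F)"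
      using rot[of "z ^ i" D] F_0 fps_eval_compose[OF F_0, of "fps_const (z ^ i) * fps_X" E]
      by (simp add: E_def G_def z_def)
    thus ?thesis using D by (simp add: E_def eval_at_conv_fps_eval)
  qed
  hence "(\<Prod>i\<in>{1..q}. fps_X - fps_const (G i)) dvd E"
    using trivial_stabilizer_inj_on[OF stab q_pos] F_0
    by (intro fps_eval_distinct_roots) (auto simp: G_def)
  then obtain Q where Q: "E = coeff_subst (fps_X ^ q) C * Q"
    by (auto simp: curve G_def elim!: dvdE)
  have C0: "coeff_subst (fps_X ^ q) C \<noteq> 0"
  proof
    assume "coeff_subst (fps_X ^ q) C = 0"
    then obtain i where "fps_X - fps_const (G i) = 0"
      by (auto simp: curve G_def)
    hence "fps_nth (fps_X - fps_const (G i)) 1 = 0" by simp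
    thus False by simp
  qed
  have "coeff_subst (fps_X ^ q) C * coeff_subst (fps_const z * fps_X) Q =
        coeff_subst (fps_X ^ q) C * Q"
    using rot[OF zq, of C] rot[OF zq, of D]
    by (metis E_def Q coeff_subst_mult fps_mult_nth_0 fps_X_nth mult_zero_right zero_neq_one)
  hence zQ: "coeff_subst (fps_const z * fps_X) Q = Q" using C0 by simp
  have Q0: "fps_nth (fps_nth Q b) n = 0" if "\<not> q dvd n" for b n
  proof -
    have "fps_nth (fps_nth Q b) n = z ^ n * fps_nth (fps_nth Q b) n"
      by (subst (1) zQ[symmetric]) (simp add: fps_compose_linear)
    moreover have "z ^ n \<noteq> 1" using primitive_root_dvd[OF z q_pos] that by blast
    ultimately show ?thesis by simp
  qed
  define R where "R = Abs_fps (\<lambda>b. Abs_fps (\<lambda>a. fps_nth (fps_nth Q b) (q * a)))"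
  have "Q = coeff_subst (fps_X ^ q) R"
  proof (rule fps_ext, rule fps_ext)
    fix b n
    show "fps_nth (fps_nth Q b) n = fps_nth (fps_nth (coeff_subst (fps_X ^ q) R) b) n"
      using Q0 q_pos by (auto simp: R_def fps_nth_compose_X_power)
  qed
  hence "coeff_subst (fps_X ^ q) D = coeff_subst (fps_X ^ q) (C * R)"
    using Q by (simp add: E_def coeff_subst_mult[OF X_power_0])
  hence "D = C * R"
    by (simp add: coeff_subst_inject[OF X_power_0])
  thus "C dvd D" by simp
qed

text \<open>All conjugates of F vanish at t = 0, so each factor becomes y. This normalization later
  detects whether a cofactor is a unit.\<close>

lemma coeff_subst_0_curve: "coeff_subst 0 C = fps_X ^ q"
proof -
  have "coeff_subst 0 C = coeff_subst 0 (coeff_subst (fps_X ^ q) C)"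
    using q_pos by (subst coeff_subst_coeff_subst) (simp_all add: X_power_0)
  also have "\<dots> = fps_X ^ q"
    by (simp add: curve coeff_subst_prod coeff_subst_diff F_0)
  finally show ?thesis .
qed

lemma curve_nonzero: "C \<noteq> 0"
  using coeff_subst_0_curve by (metis coeff_subst_0 fps_X_neq_zero power_not_zero)

text \<open>C generates the kernel of evaluation on the branch. That kernel is a prime ideal, since
  the values lie in a domain.\<close>

lemma irreducible_curve: "irreducible C"
proof (rule irreducibleI)
  show "C \<noteq> 0" by (rule curve_nonzero)
next
  have "fps_nth (fps_nth C 0) 0 = 0"
    using q_pos by (simp add: nth_0_nth_coeff_subst_0[of C] coeff_subst_0_curve del: coeff_subst_nth)
  thus "\<not> C dvd 1"
    by (metis dvdE fps_mult_nth_0 fps_one_nth mult_zero_left zero_neq_one)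
next
  fix A B assume AB: "C = A * B"
  have "eval_at A (fps_X ^ q) F * eval_at B (fps_X ^ q) F = 0"
    using eval_at_curve AB eval_at_mult[OF X_power_0 F_0] by metis
  hence "C dvd A \<or> C dvd B" by (simp add: curve_dvd_iff)
  thus "A dvd 1 \<or> B dvd 1"
    using curve_nonzero AB by auto
qed

end

section \<open>Units, germs and the coordinate changes\<close>

lemma fps_fps_is_unit_iff: "(E :: 'a::field fps fps) dvd 1 \<longleftrightarrow> fps_nth (fps_nth E 0) 0 \<noteq> 0"
proof
  assume "E dvd 1"
  then obtain D where "E * D = 1" by (metis dvdE)
  hence "fps_nth E 0 * fps_nth D 0 = 1" by (metis fps_mult_nth_0 fps_one_nth)
  thus "fps_nth (fps_nth E 0) 0 \<noteq> 0"
    by (metis fps_mult_nth_0 fps_one_nth mult_zero_left zero_neq_one)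
next
  assume "fps_nth (fps_nth E 0) 0 \<noteq> 0"
  hence "fps_nth E 0 * inverse (fps_nth E 0) = 1" by (simp add: inverse_mult_eq_1')
  hence "E * fps_right_inverse E (inverse (fps_nth E 0)) = 1" by (rule fps_right_inverse)
  thus "E dvd 1" by (metis dvd_triv_left)
qed

lemma germ_unit_mult:
  assumes "u dvd 1"
  shows "germ (u * D) = germ D"
proof -
  obtain v where v: "u * v = 1" using assms by (metis dvdE)
  hence v1: "v dvd 1" by (metis dvd_triv_right)
  have "w * D \<in> germ (u * D)" if "w dvd 1" for w
  proof -
    have "w * D = (w * v) * (u * D)" using v by (simp add: algebra_simps)
    moreover have "w * v dvd 1" using mult_dvd_mono[OF that v1] by simp
    ultimately show ?thesis unfolding germ_def by blast
  qed
  moreover have "w * (u * D) \<in> germ D" if "w dvd 1" for w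
  proof -
    have "w * (u * D) = (w * u) * D" by (simp add: mult.assoc)
    moreover have "w * u dvd 1" using mult_dvd_mono[OF that assms] by simp
    ultimately show ?thesis unfolding germ_def by blast
  qed
  ultimately show ?thesis unfolding germ_def[of D] germ_def[of "u * D"]
    by (auto simp: germ_def)
qed

lemma germ_of_units:
  assumes "D dvd 1" "E dvd 1"
  shows "germ D = germ E"
  using germ_unit_mult[OF assms(1), of 1] germ_unit_mult[OF assms(2), of 1] by simp

text \<open>The exceptional factor y^k evaluates to a nonzero power of Y and cancels, so the branch
  (XY, Y) is carried to (X, Y).\<close>

lemma eval_at_sigma2_eq_0:
  assumes "fps_nth X 0 = 0" "fps_nth Y 0 = 0" "Y \<noteq> 0" "eval_at D (X * Y) Y = 0"
  shows "eval_at (sigma2 D) X Y = 0"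
proof -
  have "Y ^ multiplicity2 D * eval_at (sigma2 D) X Y = eval_at (fps_X ^ multiplicity2 D * sigma2 D) X Y"
    using assms by (simp add: eval_at_mult eval_at_X_power)
  also have "\<dots> = 0" using assms by (simp add: sigma2_spec eval_at_subst_xy_y)
  finally show ?thesis using assms by simp
qed

text \<open>Serves the case p = 0, in which the curves miss the origin; the multiplicity is then
  0.\<close>

lemma sigma2_unit:
  assumes "D dvd 1"
  shows "sigma2 D dvd 1"
proof -
  have D: "fps_nth (fps_nth D 0) 0 \<noteq> 0" using assms by (simp add: fps_fps_is_unit_iff)
  hence "multiplicity2 D = 0"
    unfolding multiplicity2_def by (intro Least_eq_0) auto
  thus ?thesis using D by (simp add: fps_fps_is_unit_iff sigma2_def subst_xy_y_def)
qed

lemma negate_x_conv_coeff_subst: "negate_x D = coeff_subst (- fps_X) D"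
  by (simp add: negate_x_def coeff_subst_def)

lemma negate_x_negate_x: "negate_x (negate_x D) = D"
  unfolding negate_x_conv_coeff_subst
  by (subst coeff_subst_coeff_subst) (simp_all add: fps_compose_uminus)

lemma negate_x_mult: "negate_x (D * E) = negate_x D * negate_x E"
  by (simp add: negate_x_conv_coeff_subst coeff_subst_mult)

lemma negate_x_unit: "D dvd 1 \<Longrightarrow> negate_x D dvd 1"
  by (simp add: fps_fps_is_unit_iff negate_x_def)

lemma eval_at_negate_x:
  assumes "fps_nth X 0 = 0"
  shows "eval_at (negate_x D) X Y = eval_at D (- X) Y"
  using assms
  by (simp add: eval_at_conv_fps_eval negate_x_conv_coeff_subst coeff_subst_coeff_subst fps_compose_uminus)

lemma coeff_subst_negate_y:
  assumes "fps_nth h 0 = 0"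
  shows "coeff_subst h (negate_y D) = coeff_subst h D oo (- fps_X)"
proof (rule fps_ext)
  fix b
  have "((-1) ^ b * fps_nth D b) oo h = ((-1) ^ b oo h) * (fps_nth D b oo h)"
    by (rule fps_compose_mult_distrib[OF assms])
  also have "(-1) ^ b oo h = (-1) ^ b"
    by (simp add: fps_compose_uminus flip: fps_compose_power[OF assms])
  finally show "fps_nth (coeff_subst h (negate_y D)) b = fps_nth (coeff_subst h D oo (- fps_X)) b"
    by (simp add: negate_y_def fps_compose_uminus')
qed

lemma inverse_fls_conv_fps:
  assumes "fls_subdegree (f::'a::field fls) = - int p"
  obtains F where "inverse f = fps_to_fls F" "subdegree F = p" 
proof
  \<comment> \<open>For \<open>f = 0\<close> both orders are 0 by convention, and the hypothesis
    gives p = 0.\<close>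
  have *: "fls_subdegree (inverse f) = int p"
    using assms by (cases "f = 0") auto
  show "inverse f = fps_to_fls (fls_regpart (inverse f))"
    using * by simp
  thus "subdegree (fls_regpart (inverse f)) = p"
    using * by (metis fls_subdegree_fls_to_fps of_nat_eq_iff)
qed

text \<open>Each factor -y - G_i equals -(y - (-G_i)), where -G is the inverse of -g; the collected
  sign (-1)^q is a unit.\<close>

lemma germ_negate_y_assoc_curve:
  fixes g :: "'a::{alg_closed_field, field_char_0} fls"
  assumes q: "q > 0" and g: "fls_subdegree g = - int p"
  shows "germ (negate_y (assoc_curve g q)) = germ (assoc_curve (- g) q)"
proof -
  obtain G where G: "inverse g = fps_to_fls G" using inverse_fls_conv_fps[OF g] .
  have X: "fps_nth (fps_X ^ q :: 'a fps) 0 = 0" using q by simp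
  have m: "fps_nth (- fps_X :: 'a fps fps) 0 = 0" by simp
  have "coeff_subst (fps_X ^ q) (negate_y (assoc_curve g q)) =
          (\<Prod>i=1..q. (- 1) * (fps_X - fps_const (fps_rotate (zeta q ^ i) (- G))))"
    using q g G
    by (subst coeff_subst_negate_y[OF X], subst coeff_subst_assoc_curve[OF q _ G])
       (simp_all add: fps_compose_prod_distrib[OF m] fps_compose_sub_distrib fps_compose_uminus
         flip: fps_const_neg)
  also have "\<dots> = (- 1) ^ q * coeff_subst (fps_X ^ q) (assoc_curve (- g) q)"
    using g G by (subst coeff_subst_assoc_curve[OF q, of _ "- G"]) (simp_all only: prod.distrib, simp_all)
  also have "\<dots> = coeff_subst (fps_X ^ q) ((- 1) ^ q * assoc_curve (- g) q)"
    by (cases "even q") (simp_all add: coeff_subst_uminus)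
  finally have "negate_y (assoc_curve g q) = (- 1) ^ q * assoc_curve (- g) q"
    using X by (subst (asm) coeff_subst_inject) auto
  moreover have "(- 1) ^ q dvd (1 :: 'a fps fps)"
    by (cases "even q") simp_all
  ultimately show ?thesis by (metis germ_unit_mult)
qed

lemma fps_prod_nth_0: "fps_nth (prod G A) 0 = (\<Prod>i\<in>A. fps_nth (G i :: 'a::comm_ring_1 fps) 0)"
  by (induction A rule: infinite_finite_induct) simp_all

lemma assoc_curve_unit:
  fixes f :: "'a::{alg_closed_field, field_char_0} fls"
  assumes q: "q > 0" and "fls_subdegree f = 0" "f \<noteq> 0"
  shows "assoc_curve f q dvd 1"
proof -
  obtain F where F: "inverse f = fps_to_fls F" "subdegree F = 0"
    using inverse_fls_conv_fps[of f 0] assms by auto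
  hence "F \<noteq> 0" using assms by auto
  hence F0: "fps_nth F 0 \<noteq> 0" using F(2) by (metis nth_subdegree_nonzero)
  have "fps_nth (fps_nth (assoc_curve f q) 0) 0 =
        fps_nth (fps_nth (coeff_subst (fps_X ^ q) (assoc_curve f q)) 0) 0" by simp
  also have "\<dots> = (- fps_nth F 0) ^ q"
    using assms by (subst coeff_subst_assoc_curve[OF q _ F(1)]) (simp_all add: fps_prod_nth_0)
  finally show ?thesis using F0 by (simp add: fps_fps_is_unit_iff)
qed

section \<open>Roots, uniformizers and changes of parameter\<close>

lemma fps_root_exists:
  fixes F :: "'a::{alg_closed_field, field_char_0} fps"
  assumes "k > 0" "subdegree F = k"
  obtains th where "uniformizer th" "th ^ k = F"
proof -
  obtain th where "uniformizer th" "fps_to_fls th ^ k = fps_to_fls F"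
    using uniformizer_exists[of k "fps_to_fls F"] assms by (auto simp: fls_subdegree_fls_to_fps)
  thus ?thesis using that by (simp flip: fps_to_fls_power)
qed

text \<open>The cofactor of u - 1 in u^q - 1 has constant term q, which is nonzero in characteristic
  zero.\<close>

lemma fps_power_eq_1:
  fixes u :: "'a::field_char_0 fps"
  assumes "u ^ q = 1" "fps_nth u 0 = 1" "q > 0"
  shows "u = 1"
proof -
  have "(u - 1) * (\<Sum>i<q. u ^ i) = 0"
    using assms(1) by (simp flip: power_diff_1_eq)
  moreover have "fps_nth (\<Sum>i<q. u ^ i) 0 \<noteq> 0"
    using assms by (simp add: fps_sum_nth fps_nth_power_0)
  ultimately show ?thesis by auto
qed

text \<open>Rotations are the only reparametrizations that preserve t^q: u/t, divided by its
  constant term, is a q-th root of 1 with constant term 1.\<close>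

lemma fps_power_eq_X_power:
  fixes u :: "'a::field_char_0 fps"
  assumes "u ^ q = fps_X ^ q" "fps_nth u 0 = 0" "q > 0"
  obtains w where "u = fps_const w * fps_X" "w ^ q = 1"
proof -
  have "u = fps_X * fps_shift 1 u" using assms by (simp add: fps_eq_iff)
  then obtain v where v: "u = fps_X * v" by blast
  hence vq: "v ^ q = 1" using assms by (simp add: power_mult_distrib)
  define w where "w = fps_nth v 0"
  have wq: "w ^ q = 1" using vq by (metis fps_nth_power_0 fps_one_nth w_def)
  hence w0: "w \<noteq> 0" using assms by (auto simp: power_0_left)
  have "fps_const (inverse w) * v = 1"
  proof (rule fps_power_eq_1[OF _ _ assms(3)])
    show "(fps_const (inverse w) * v) ^ q = 1"
      by (simp add: power_mult_distrib vq wq power_inverse fps_const_power)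
    show "fps_nth (fps_const (inverse w) * v) 0 = 1" using w0 by (simp add: w_def)
  qed
  hence "fps_const w * (fps_const (inverse w) * v) = fps_const w" by simp
  hence "v = fps_const w" using w0 by (simp add: mult.assoc[symmetric])
  thus ?thesis using that wq v by (simp add: mult.commute)
qed

lemma uniformizer_inv:
  assumes "uniformizer th"
  shows "uniformizer (fps_inv th)" "th oo fps_inv th = fps_X" "fps_inv th oo th = fps_X"
proof -
  have th: "fps_nth th 0 = 0" "fps_nth th 1 \<noteq> 0" using assms by (auto simp: uniformizer_def)
  show *: "th oo fps_inv th = fps_X" "fps_inv th oo th = fps_X"
    using th by (rule fps_inv_right fps_inv)+
  have 0: "fps_nth (fps_inv th) 0 = 0" by (simp add: fps_inv_def)
  have "fps_nth (th oo fps_inv th) 1 = 1" by (simp add: *)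
  hence "fps_nth th 1 * fps_nth (fps_inv th) 1 = 1"
    by (simp add: fps_compose_nth 0)
  hence "fps_nth (fps_inv th) 1 \<noteq> 0" by auto
  thus "uniformizer (fps_inv th)" using 0 by (simp add: uniformizer_def)
qed

lemma uniformizer_compose:
  assumes "uniformizer h" "uniformizer k"
  shows "uniformizer (h oo k)"
  using assms by (auto simp: uniformizer_def fps_compose_nth)

section \<open>Multiplicity and primitive parametrizations\<close>

context branch
begin

text \<open>Vanishing on the branch makes D a multiple of C. As both restrict to y^q on x = 0, the
  cofactor restricts to 1 there and is a unit.\<close>

lemma germ_eqI:
  assumes "eval_at D (fps_X ^ q) F = 0" "coeff_subst 0 D = fps_X ^ q"
  shows "germ D = germ C"
proof -
  obtain R where R: "D = C * R" using assms(1) curve_dvd_iff by (metis dvdE)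
  have "fps_X ^ q * coeff_subst 0 R = fps_X ^ q * 1"
    using assms(2) by (simp add: R coeff_subst_mult coeff_subst_0_curve)
  hence "coeff_subst 0 R = 1" by (subst (asm) mult_cancel_left) simp
  hence "fps_nth (fps_nth R 0) 0 = 1"
    by (subst nth_0_nth_coeff_subst_0) simp
  hence "R dvd 1" by (simp add: fps_fps_is_unit_iff)
  thus ?thesis by (simp add: R mult.commute[of C] germ_unit_mult)
qed

text \<open>The substitution y \<mapsto> t^p y makes every factor y - F_i of the curve divisible by t^p,
  which gives the Newton polygon of the curve.\<close>
lemma newton_polygon:
  assumes "subdegree F = p"
  shows "\<And>a b. fps_nth (fps_nth C b) a \<noteq> 0 \<Longrightarrow> p * q \<le> q * a + p * b"
    and "F \<noteq> 0 \<Longrightarrow> fps_nth (fps_nth C 0) p \<noteq> 0"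
proof -
  define s :: "'a fps fps" where "s = fps_const (fps_X ^ p) * fps_X"
  have s0: "fps_nth s 0 = 0" by (simp add: s_def)
  have "F = fps_X ^ p * fps_shift p F"
    using assms by (metis mult.commute subdegree_decompose)
  then obtain F' where F': "F = fps_X ^ p * F'" "F' = fps_shift p F" by blast
  define z :: 'a where "z = zeta q"
  have z0: "z \<noteq> 0" using primitive_root_nonzero[OF primitive_root_zeta q_pos] q_pos by (simp add: z_def)
  define G where "G i = fps_const ((z ^ i) ^ p) * fps_rotate (z ^ i) F'" for i
  have FG: "fps_rotate (z ^ i) F = fps_X ^ p * G i" for i
    by (subst F'(1)) (simp add: G_def fps_compose_mult_distrib fps_X_power_compose power_mult_distrib
          fps_const_power mult_ac)
  define H where "H = (\<Prod>i=1..q. fps_X - fps_const (G i))"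
  have "coeff_subst (fps_X ^ q) C oo s = (\<Prod>i=1..q. fps_const (fps_X ^ p) * (fps_X - fps_const (G i)))"
    unfolding curve fps_compose_prod_distrib[OF s0]
    by (intro prod.cong refl)
       (simp add: fps_compose_sub_distrib s_def FG[unfolded z_def] right_diff_distrib fps_X_fps_compose_startby0)
  also have "\<dots> = fps_const (fps_X ^ (p * q)) * H"
    by (simp add: prod.distrib H_def fps_const_power flip: power_mult)
  finally have "fps_nth (coeff_subst (fps_X ^ q) C oo s) b = fps_nth (fps_const (fps_X ^ (p * q)) * H) b" for b
    by (rule arg_cong)
  hence CH: "fps_X ^ (p * b) * fps_nth (coeff_subst (fps_X ^ q) C) b = fps_X ^ (p * q) * fps_nth H b" for b
    by (simp add: s_def flip: power_mult)
  \<comment> \<open>The substitutions turn x^a y^b into t^(q a + p b) y^b, while the exponents of t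
    on the right are at least p q. For a = p and b = 0 these bounds meet, leaving the constant term
    of \<open>H\<close>.\<close>
  have C: "fps_nth (fps_nth C b) a = fps_nth (fps_X ^ (p * q) * fps_nth H b) (q * a + p * b)" for a b
    using q_pos by (simp add: CH[symmetric] fps_X_power_mult_nth fps_nth_compose_X_power)
  show "p * q \<le> q * a + p * b" if "fps_nth (fps_nth C b) a \<noteq> 0" for a b
    using that unfolding C by (auto simp: fps_X_power_mult_nth split: if_splits)
  assume "F \<noteq> 0"
  hence "fps_nth F' 0 \<noteq> 0" using nth_subdegree_nonzero[of F] by (simp add: F'(2) assms)
  hence "fps_nth (fps_nth H 0) 0 \<noteq> 0"
    using z0 by (simp add: H_def fps_prod_nth_0 G_def)
  thus "fps_nth (fps_nth C 0) p \<noteq> 0"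
    unfolding C by (simp add: fps_X_power_mult_nth mult.commute[of q])
qed

text \<open>Since p < q, the vertex x^p of the Newton polygon has the lowest degree: p q \<le> q a +
  p b \<le> q (a + b).\<close>

lemma multiplicity2_curve:
  assumes "subdegree F = p" "p < q" "F \<noteq> 0"
  shows "multiplicity2 C = p"
  unfolding multiplicity2_def
proof (rule Least_equality)
  show "\<exists>a b. a + b = p \<and> fps_nth (fps_nth C b) a \<noteq> 0"
    using newton_polygon(2)[OF assms(1,3)] by (intro exI[of _ p] exI[of _ 0]) simp
next
  fix k assume "\<exists>a b. a + b = k \<and> fps_nth (fps_nth C b) a \<noteq> 0"
  then obtain a b where ab: "k = a + b" "fps_nth (fps_nth C b) a \<noteq> 0" by blast
  have "p * q \<le> q * a + p * b" using newton_polygon(1)[OF assms(1) ab(2)] .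
  also have "p * b \<le> q * b" using assms by simp
  finally have "q * p \<le> q * (a + b)" by (simp add: algebra_simps)
  thus "p \<le> k" using q_pos ab by simp
qed

text \<open>Replacing x by x y does not affect the restriction y^q to x = 0; removing the
  exceptional factor y^p leaves y^(q - p).\<close>

lemma coeff_subst_0_sigma2:
  assumes "subdegree F = p" "p < q" "F \<noteq> 0"
  shows "coeff_subst 0 (sigma2 C) = fps_X ^ (q - p)"
proof -
  have "fps_X ^ p * coeff_subst 0 (sigma2 C) = coeff_subst 0 (fps_X ^ p * sigma2 C)"
  proof -
    have "coeff_subst 0 (fps_X ^ k) = (fps_X ^ k :: 'a fps fps)" for k
      by (induction k) (simp_all add: coeff_subst_mult)
    thus ?thesis by (simp add: coeff_subst_mult)
  qed
  also have "\<dots> = coeff_subst 0 (subst_xy_y C)"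
    using sigma2_spec[of C] by (simp add: multiplicity2_curve[OF assms])
  also have "\<dots> = coeff_subst 0 C"
    by (rule fps_ext) (simp add: subst_xy_y_def)
  also have "\<dots> = fps_X ^ p * fps_X ^ (q - p)"
    using assms(2) by (simp add: coeff_subst_0_curve flip: power_add)
  finally show ?thesis by simp
qed

text \<open>A parametrization through v^d is invariant under v \<mapsto> \<zeta> v for every d-th root of unity.\<close>
lemma good_paramI:
  assumes "C dvd D" "uniformizer k"
  shows "good_param D (fps_X ^ q oo k) (F oo k)"
  unfolding good_param_def
proof (intro conjI allI impI; (elim conjE)?)
  have k0: "fps_nth k 0 = 0" using assms(2) by (simp add: uniformizer_def)
  show "fps_nth (fps_X ^ q oo k) 0 = 0" "fps_nth (F oo k) 0 = 0" using X_power_0 F_0 by simp_all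
  show "eval_at D (fps_X ^ q oo k) (F oo k) = 0"
    using assms(1) by (simp add: curve_dvd_iff eval_at_compose[OF X_power_0 F_0 k0])
  fix X Y h assume h0: "fps_nth h 0 = 0" and X: "fps_X ^ q oo k = X oo h" and Y: "F oo k = Y oo h"
  show "fps_nth h 1 \<noteq> 0"
  proof
    assume h1: "fps_nth h 1 = 0"
    \<comment> \<open>Undoing the change of parameter \<open>k\<close> gives a factorization of
      (t^q, F) itself through \<open>h'\<close>, again without linear term.\<close>
    define l where "l = fps_inv k"
    have l: "uniformizer l" "k oo l = fps_X" using uniformizer_inv[OF assms(2)] by (simp_all add: l_def)
    hence l0: "fps_nth l 0 = 0" by (simp add: uniformizer_def)
    define h' where "h' = h oo l"
    have h'0: "fps_nth h' 0 = 0" "fps_nth h' 1 = 0"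
      using h0 h1 by (simp_all add: h'_def fps_compose_nth)
    have X': "X oo h' = fps_X ^ q" "Y oo h' = F"
      unfolding h'_def fps_compose_assoc[OF l0 h0] X[symmetric] Y[symmetric]
      by (simp_all add: l(2) fps_compose_assoc[OF l0 k0, symmetric])
    have "h' \<noteq> 0"
    proof
      assume "h' = 0"
      hence "fps_nth (X oo h') q = 0" using q_pos by simp
      thus False using X' by simp
    qed
    define d where "d = subdegree h'"
    have d: "d > 1"
    proof -
      have "fps_nth h' d \<noteq> 0" using \<open>h' \<noteq> 0\<close> by (simp add: d_def)
      hence "d \<noteq> 0" "d \<noteq> 1" using h'0 by metis+
      thus ?thesis by linarith
    qed
    obtain v where v: "uniformizer v" "v ^ d = h'"
      using fps_root_exists[OF _ d_def[symmetric]] d by (metis less_trans zero_less_one)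
    hence v0: "fps_nth v 0 = 0" by (simp add: uniformizer_def)
    define z :: 'a where "z = zeta d"
    have z: "primitive_root d z" using primitive_root_zeta[of d] d by (simp add: z_def)
    \<comment> \<open>The rotation by \<open>z\<close> in the coordinate \<open>v\<close>. It fixes
      \<open>h' = v ^ d\<close>, hence t^q and F, so it is a rotation in the stabilizer of F and
      must be trivial. Then \<open>z = 1\<close>, although its order is d > 1.\<close>
    define w where "w = fps_inv v oo (fps_const z * v)"
    have iv: "uniformizer (fps_inv v)" "v oo fps_inv v = fps_X" "fps_inv v oo v = fps_X"
      using uniformizer_inv[OF v(1)] by simp_all
    hence iv0: "fps_nth (fps_inv v) 0 = 0" by (simp add: uniformizer_def)
    have w0: "fps_nth w 0 = 0" using iv0 by (simp add: w_def)
    have zv0: "fps_nth (fps_const z * v) 0 = 0" using v0 by simp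
    have vw: "v oo w = fps_const z * v"
      unfolding w_def fps_compose_assoc[OF zv0 iv0] iv(2) using v0 by (simp add: fps_X_fps_compose_startby0)
    have "z ^ d = 1" using z by (simp add: primitive_root_def)
    hence h'w: "h' oo w = h'"
      using vw v(2) by (simp add: power_mult_distrib fps_const_power flip: v(2) fps_compose_power[OF w0])
    have "fps_X ^ q oo w = fps_X ^ q" "F oo w = F"
      using h'w unfolding X'[symmetric] by (simp_all add: fps_compose_assoc[OF w0 h'0(1), symmetric])
    then obtain c where c: "w = fps_const c * fps_X" "c ^ q = 1" and Fw: "F oo w = F"
      using fps_power_eq_X_power[OF _ w0 q_pos] by (auto simp: fps_X_power_compose[OF w0])
    hence "c = 1" using stab by (simp add: trivial_stabilizer_def)
    hence "v = fps_const z * v" using vw c by simp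
    hence "fps_nth v 1 = z * fps_nth v 1" by (metis fps_mult_left_const_nth)
    hence "z ^ 1 = 1" using v(1) by (simp add: uniformizer_def)
    thus False using z d unfolding primitive_root_def by (metis zero_less_one)
  qed
qed

end

text \<open>A rotation of theta is a reparametrization u of t that preserves F and theta^m. The
  hypothesis \<open>step\<close> is where the equation for theta enters: it makes u preserve t^q, so
  u is a rotation fixing F.\<close>

lemma trivial_stabilizer_transfer:
  fixes F :: "'a::field_char_0 fps"
  assumes stab: "trivial_stabilizer q F" and th: "uniformizer th" and "q > 0"
    and step: "\<And>u. fps_nth u 0 = 0 \<Longrightarrow> F oo u = F \<Longrightarrow> (th oo u) ^ m = th ^ m \<Longrightarrow> u ^ q = fps_X ^ q"
  shows "trivial_stabilizer m (F oo fps_inv th)"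
  unfolding trivial_stabilizer_def
proof (intro allI impI, elim conjE)
  fix w assume w: "w ^ m = 1" "fps_rotate w (F oo fps_inv th) = F oo fps_inv th"
  define h where "h = fps_inv th"
  have h: "uniformizer h" "th oo h = fps_X" "h oo th = fps_X"
    using uniformizer_inv[OF th] by (simp_all add: h_def)
  have 0: "fps_nth h 0 = 0" "fps_nth th 0 = 0" "fps_nth (fps_const w * fps_X) 0 = 0"
    using h(1) th by (simp_all add: uniformizer_def)
  have wth: "fps_const w * fps_X oo th = fps_const w * th"
    using 0 by (simp add: fps_compose_mult_distrib fps_X_fps_compose_startby0)
  have 1: "fps_nth (fps_const w * th) 0 = 0" using 0 by simp
  define u where "u = h oo (fps_const w * th)"
  have u0: "fps_nth u 0 = 0" using 0 by (simp add: u_def)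
  have Fu: "F oo u = F"
  proof -
    have "F oo u = (F oo h) oo (fps_const w * fps_X oo th)"
      unfolding u_def wth by (rule fps_compose_assoc[OF 1 0(1)])
    also have "\<dots> = fps_rotate w (F oo h) oo th"
      by (rule fps_compose_assoc[OF 0(2,3)])
    also have "\<dots> = F oo (h oo th)"
      using w(2) by (simp add: h_def[symmetric] fps_compose_assoc[OF 0(2,1)])
    finally show ?thesis by (simp add: h)
  qed
  have thu: "th oo u = fps_const w * th"
    unfolding u_def fps_compose_assoc[OF 1 0(1)] h using 1 by (simp add: fps_X_fps_compose_startby0)
  hence "(th oo u) ^ m = th ^ m" using w(1) by (simp add: power_mult_distrib fps_const_power)
  hence "u ^ q = fps_X ^ q" using step u0 Fu by blast
  then obtain c where c: "u = fps_const c * fps_X" "c ^ q = 1"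
    using fps_power_eq_X_power u0 assms(3) by blast
  hence "c = 1" using stab Fu by (auto simp: trivial_stabilizer_def)
  hence "th = fps_const w * th" using thu c by simp
  hence "fps_nth th 1 = w * fps_nth th 1" by (metis fps_mult_left_const_nth)
  thus "w = 1" using th by (simp add: uniformizer_def)
qed

section \<open>Transformed branches\<close>

lemma dvd_irreducible_imp_germ_eq:
  assumes "irreducible D" "C dvd D" "\<not> C dvd 1"
  shows "germ D = germ C"
proof -
  obtain u where u: "D = u * C" using assms(2) by (metis dvdE mult.commute)
  hence "u dvd 1" using assms irreducibleD by blast
  thus ?thesis using u germ_unit_mult by metis
qed

lemma irreducible_unit_mult:
  fixes C :: "'a::field fps fps"
  assumes "irreducible C" "u dvd 1"
  shows "irreducible (u * C)"
proof (rule irreducibleI)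
  obtain v where v: "v * u = 1" using assms(2) by (metis dvdE mult.commute)
  show "u * C \<noteq> 0" using assms v by (auto simp: irreducible_def)
  show "\<not> u * C dvd 1" using assms by (metis dvd_mult_right irreducible_not_unit)
  fix A B assume "u * C = A * B"
  hence "C = (v * A) * B" by (metis v mult.assoc mult_1)
  hence "v * A dvd 1 \<or> B dvd 1" using assms(1) irreducibleD by blast
  thus "A dvd 1 \<or> B dvd 1" by (metis dvd_mult_right)
qed

lemma good_paramD:
  "good_param C X Y \<Longrightarrow> fps_nth X 0 = 0 \<and> fps_nth Y 0 = 0 \<and> eval_at C X Y = 0"
  by (simp add: good_param_def)

text \<open>Once the first coordinate is a q-th power s^q, the equation splits into the factors Y -
  F(zeta^i s), one of which must vanish.\<close>

lemma (in branch) param_factors: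
  assumes "eval_at C (s ^ q) Y = 0" "fps_nth s 0 = 0" "fps_nth Y 0 = 0"
  obtains i where "Y = F oo (fps_const (zeta q ^ i) * s)"
proof -
  have r0: "fps_nth (fps_const c * s) 0 = 0" for c using assms(2) by simp
  have "coeff_subst (s ^ q) C = coeff_subst s (coeff_subst (fps_X ^ q) C)"
    by (simp add: coeff_subst_coeff_subst[OF X_power_0 assms(2)] fps_X_power_compose[OF assms(2)])
  also have "\<dots> = (\<Prod>i=1..q. fps_X - fps_const (fps_rotate (zeta q ^ i) F oo s))"
    by (simp add: curve coeff_subst_prod[OF assms(2)] coeff_subst_diff)
  finally have "eval_at C (s ^ q) Y = (\<Prod>i=1..q. Y - (fps_rotate (zeta q ^ i) F oo s))"
    by (simp add: eval_at_conv_fps_eval fps_eval_prod[OF assms(3)] fps_eval_X_minus[OF assms(3)])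
  then obtain i where "Y = fps_rotate (zeta q ^ i) F oo s" using assms(1) by auto
  also have "\<dots> = F oo (fps_const (zeta q ^ i) * fps_X oo s)"
    by (rule fps_compose_assoc[symmetric]) (simp_all add: assms(2))
  also have "fps_const (zeta q ^ i) * fps_X oo s = fps_const (zeta q ^ i) * s"
    by (simp add: fps_compose_mult_distrib[OF assms(2)] assms(2) fps_X_fps_compose_startby0)
  finally show ?thesis using that by blast
qed

lemma subdegree_X_power_mult:
  "fps_nth a 0 \<noteq> 0 \<Longrightarrow> subdegree (fps_X ^ i * a) = i"
  by (rule subdegreeI) (simp_all add: fps_X_power_mult_nth)

text \<open>For one inclusion, both branches are written in a parameter in which F is a pure power.
  For the other, an arbitrary admissible parametrization is pulled back from (t^q, F), so that D
  vanishes on (theta^m, F).\<close>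

lemma germ_eq_sigma3:
  assumes C: "branch F q C" and C': "branch (F oo fps_inv th) m C'"
    and p: "subdegree F = p" "q < p" and m: "m = p - q"
    and th: "uniformizer th" "th ^ m * fps_X ^ q = F"
  shows "germ C' = sigma3 C"
proof (intro equalityI subsetI)
  interpret C: branch F q C by (rule C)
  interpret C': branch "F oo fps_inv th" m C' by (rule C')
  have th0: "fps_nth th 0 = 0" using th by (simp add: uniformizer_def)
  have inv0: "fps_nth (fps_inv th) 0 = 0"
    using uniformizer_inv(1)[OF th(1)] by (simp add: uniformizer_def)
  have mq: "m + q = p" using p m by simp

  fix D assume "D \<in> germ C'"
  then obtain u where u: "D = u * C'" "u dvd 1" by (auto simp: germ_def)
  have D: "irreducible D" using irreducible_unit_mult C'.irreducible_curve u by metis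
  \<comment> \<open>In the parameter s the second coordinate is s^p, as required with n = p. The
    series \<open>k\<close> expresses t through s, and alpha is the q-th power of \<open>b\<close>,
    that is of t/s.\<close>
  obtain s where s: "uniformizer s" "s ^ p = F" using fps_root_exists[of p F] p by auto
  define k where "k = fps_inv s"
  have k: "uniformizer k" "s oo k = fps_X" using uniformizer_inv[OF s(1)] by (simp_all add: k_def)
  hence k0: "fps_nth k 0 = 0" by (simp add: uniformizer_def)
  define b where "b = fps_shift 1 k"
  have kb: "k = fps_X * b" using k0 by (simp add: b_def fps_eq_iff)
  have b0: "fps_nth b 0 \<noteq> 0" using k by (simp add: b_def uniformizer_def)
  have Fk: "F oo k = fps_X ^ p"
    by (simp add: k(2) flip: s(2) fps_compose_power[OF k0])
  have Xk: "fps_X ^ q oo k = fps_X ^ q * b ^ q"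
    unfolding fps_X_power_compose[OF k0] by (simp add: kb power_mult_distrib)
  have good: "good_param C (fps_X ^ q * b ^ q) (fps_X ^ p)"
    using C.good_paramI[OF dvd_refl k(1)] by (simp add: Fk Xk)
  have thk: "uniformizer (th oo k)" using uniformizer_compose th k by blast
  have thk0: "fps_nth (th oo k) 0 = 0" using th0 by simp
  have "F oo fps_inv th oo (th oo k) = F oo fps_inv th oo th oo k"
    by (rule fps_compose_assoc[OF k0 th0])
  also have "F oo fps_inv th oo th = F"
    by (simp add: uniformizer_inv(3)[OF th(1)] flip: fps_compose_assoc[OF th0 inv0])
  finally have Yk: "F oo fps_inv th oo (th oo k) = fps_X ^ p" by (simp add: Fk)
  \<comment> \<open>The equation theta^m t^q = F in the parameter s; cancelling s^q gives theta^m =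
    s^(p - q) / alpha.\<close>
  have "(th oo k) ^ m * (fps_X ^ q * b ^ q) = fps_X ^ m * fps_X ^ q"
  proof -
    have "(th ^ m oo k) * (fps_X ^ q oo k) = F oo k"
      by (simp add: th(2) flip: fps_compose_mult_distrib[OF k0])
    thus ?thesis unfolding Xk Fk fps_compose_power[OF k0] by (simp add: mq flip: power_add)
  qed
  hence "fps_X ^ q * ((th oo k) ^ m * b ^ q) = fps_X ^ q * fps_X ^ m"
    by (simp only: mult_ac)
  hence "(th oo k) ^ m * b ^ q = fps_X ^ m" by (subst (asm) mult_cancel_left) simp
  hence "(th oo k) ^ m * (b ^ q * inverse (b ^ q)) = fps_X ^ m * inverse (b ^ q)"
    by (metis mult.assoc)
  moreover have "b ^ q * inverse (b ^ q) = 1"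
    using b0 by (simp add: inverse_mult_eq_1' fps_nth_power_0)
  ultimately have "fps_X ^ m oo (th oo k) = fps_X ^ m * inverse (b ^ q)"
    by (simp add: fps_X_power_compose[OF thk0])
  hence "good_param D (fps_X ^ (p - q) * inverse (b ^ q)) (fps_X ^ p)"
    using C'.good_paramI[OF _ thk, of D] by (simp add: u Yk m)
  moreover have "fps_nth (b ^ q) 0 \<noteq> 0" "q \<le> p" using b0 p by (simp_all add: fps_nth_power_0)
  ultimately show "D \<in> sigma3 C"
    unfolding sigma3_def using C.irreducible_curve D good by blast
next
  interpret C: branch F q C by (rule C)
  interpret C': branch "F oo fps_inv th" m C' by (rule C')
  note q = C.q_pos and m_pos = C'.q_pos
  have th0: "fps_nth th 0 = 0" using th by (simp add: uniformizer_def)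
  have inv0: "fps_nth (fps_inv th) 0 = 0" and inv_nz: "fps_inv th \<noteq> 0"
    using uniformizer_inv(1)[OF th(1)] by (auto simp: uniformizer_def)

  fix D assume "D \<in> sigma3 C"
  then obtain i n a where D: "irreducible D" and a: "fps_nth a 0 \<noteq> 0" "i \<le> n"
    "good_param C (fps_X ^ i * a) (fps_X ^ n)"
    "good_param D (fps_X ^ (n - i) * inverse a) (fps_X ^ n)"
    by (auto simp: sigma3_def)
  define X where "X = fps_X ^ i * a"
  define X1 where "X1 = fps_X ^ (n - i) * inverse a"
  define Y where "Y = (fps_X ^ n :: 'a fps)"
  have XY: "fps_nth X 0 = 0" "fps_nth Y 0 = 0" "eval_at C X Y = 0"
    and X1: "fps_nth X1 0 = 0" "eval_at D X1 Y = 0"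
    unfolding X_def X1_def Y_def using good_paramD[OF a(3)] good_paramD[OF a(4)] by blast+
  have "X1 * X = (fps_X ^ (n - i) * fps_X ^ i) * (a * inverse a)"
    by (simp add: X_def X1_def mult_ac)
  hence X1X: "X1 * X = Y"
    using a by (simp add: Y_def inverse_mult_eq_1' flip: power_add)
  have X_nz: "X \<noteq> 0" using a by (auto simp: X_def)
  \<comment> \<open>X itself need not be a q-th power, but X(t^q) is.\<close>
  define r where "r = (fps_X ^ q :: 'a fps)"
  have r: "fps_nth r 0 = 0" "r \<noteq> 0" using C.X_power_0 by (simp_all add: r_def)
  have i: "i > 0" using XY(1) a by (cases i) (auto simp: X_def)
  have "subdegree X = i" using a by (simp add: X_def subdegree_X_power_mult)
  then obtain v where v: "uniformizer v" "v ^ i = X" using fps_root_exists[OF i] by blast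
  have v0: "fps_nth v 0 = 0" using v by (simp add: uniformizer_def)
  have "subdegree (v oo r) = q"
  proof -
    have "v = fps_X * fps_shift 1 v" using v0 by (simp add: fps_eq_iff)
    hence "v oo r = r * (fps_shift 1 v oo r)"
      by (metis fps_compose_mult_distrib[OF r(1)] fps_X_fps_compose_startby0[OF r(1)])
    moreover have "fps_nth (fps_shift 1 v oo r) 0 \<noteq> 0" using v by (simp add: uniformizer_def)
    ultimately show ?thesis by (simp add: r_def subdegree_X_power_mult)
  qed
  then obtain w where w: "uniformizer w" "w ^ q = v oo r" using fps_root_exists[OF q] by blast
  define s where "s = w ^ i"
  have "X oo r = (v oo r) ^ i" by (simp add: fps_compose_power[OF r(1)] v(2))
  also have "\<dots> = s ^ q" by (simp add: s_def mult.commute flip: w(2) power_mult)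
  finally have Xr: "X oo r = s ^ q" .
  have s0: "fps_nth s 0 = 0" using w i by (simp add: s_def uniformizer_def)
  have Yr0: "fps_nth (Y oo r) 0 = 0" using XY by simp
  have "eval_at C (s ^ q) (Y oo r) = 0"
    using XY r by (simp add: eval_at_compose flip: Xr)
  then obtain j where j: "Y oo r = F oo (fps_const (zeta q ^ j) * s)"
    using C.param_factors s0 Yr0 by blast
  \<comment> \<open>Absorbs the conjugation into the parameter without changing the q-th power
    s^q.\<close>
  define s' where "s' = fps_const (zeta q ^ j) * s"
  have s'0: "fps_nth s' 0 = 0" using s0 by (simp add: s'_def)
  have "(zeta q ^ j) ^ q = (1 :: 'a)"
    using primitive_root_zeta[OF q, where ?'a = 'a]
    by (metis mult.commute power_mult power_one primitive_root_def)
  hence Xs': "X oo r = s' ^ q"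
    by (simp add: Xr s'_def power_mult_distrib fps_const_power)
  have Xr_nz: "X oo r \<noteq> 0" using X_nz r by (simp add: fps_compose_eq_0_iff)
  hence s'_nz: "s' \<noteq> 0" using Xs' q by auto
  \<comment> \<open>Both X1 X = Y and theta^m t^q = F express the second coordinate; cancelling the
    common first coordinate identifies X1 with theta^m. Then \<open>s'\<close> can be removed, as
    composition with it is injective.\<close>
  have "(X1 oo r) * (X oo r) = (th ^ m oo s') * (X oo r)"
  proof -
    have "(X1 oo r) * (X oo r) = F oo s'"
      using j r by (simp add: s'_def X1X flip: fps_compose_mult_distrib)
    also have "\<dots> = (th ^ m oo s') * (fps_X ^ q oo s')"
      by (simp add: th(2) flip: fps_compose_mult_distrib[OF s'0])
    also have "fps_X ^ q oo s' = X oo r" by (simp add: Xs' fps_X_power_compose[OF s'0])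
    finally show ?thesis .
  qed
  hence X1r: "X1 oo r = th ^ m oo s'" using Xr_nz by simp
  have thm0: "fps_nth (th ^ m) 0 = 0" using th0 m_pos by (simp add: fps_nth_power_0)
  have "eval_at D (th ^ m oo s') (F oo s') = 0"
    using X1 XY r eval_at_compose[of X1 Y r D] by (simp add: j X1r s'_def)
  hence "eval_at D (th ^ m) F = 0"
    using eval_at_compose_eq_0_iff[OF thm0 C.F_0 s'0 s'_nz] by blast
  hence "eval_at D (th ^ m oo fps_inv th) (F oo fps_inv th) = 0"
    using eval_at_compose_eq_0_iff[OF thm0 C.F_0 inv0 inv_nz] by blast
  hence "eval_at D (fps_X ^ m) (F oo fps_inv th) = 0"
    by (simp add: uniformizer_inv(2)[OF th(1)] flip: fps_compose_power[OF inv0])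
  hence "C' dvd D" by (simp add: C'.curve_dvd_iff)
  hence "germ D = germ C'"
    using dvd_irreducible_imp_germ_eq[OF D] C'.irreducible_curve irreducible_not_unit by blast
  moreover have "D \<in> germ D" unfolding germ_def by (auto intro!: exI[of _ 1])
  ultimately show "D \<in> germ C'" by simp
qed

lemma compose_uniformizer_inverse:
  fixes f :: "'a::field fls"
  assumes "uniformizer h" and "inverse f = fps_to_fls F" and "fls_subdegree f = - int p" "f \<noteq> 0"
  shows "inverse (fls_compose_fps f h) = fps_to_fls (F oo h)"
    and "fls_subdegree (fls_compose_fps f h) = - int p" and "fls_compose_fps f h \<noteq> 0"
    and "subdegree (F oo h) = p"
proof -
  have h: "h \<noteq> 0" "fps_nth h 0 = 0" "subdegree h = 1"
    using assms(1) by (auto simp: uniformizer_def intro!: subdegreeI)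
  show inv: "inverse (fls_compose_fps f h) = fps_to_fls (F oo h)"
    using h by (simp add: assms(2) flip: fls_compose_fps_inverse)
  show nz: "fls_compose_fps f h \<noteq> 0" using h assms(4) by (simp add: fls_compose_fps_eq_0_iff)
  show sub: "fls_subdegree (fls_compose_fps f h) = - int p" using h assms(3) by simp
  have "int (subdegree (F oo h)) = fls_subdegree (inverse (fls_compose_fps f h))"
    by (simp add: inv fls_subdegree_fls_to_fps)
  also have "\<dots> = int p" using nz sub by simp
  finally show "subdegree (F oo h) = p" by simp
qed

lemma branch_assoc_curve:
  fixes f :: "'a::{alg_closed_field, field_char_0} fls"
  assumes "inverse f = fps_to_fls F" "fls_subdegree f = - int p" "q > 0" "trivial_stabilizer q F"
    and "fps_nth F 0 = 0"
  shows "branch F q (assoc_curve f q)"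
  using assms by unfold_locales (simp_all add: coeff_subst_assoc_curve)

theorem proposition3p8:
  fixes f :: "'a::{alg_closed_field, field_char_0} fls" and p q :: nat
  assumes "q > 0"
    and "R_class q f \<in> R_o q - {R_class q 0}"
    and "fls_subdegree f = - int p"
  shows
    "(p < q \<longrightarrow> (\<forall>g. lft_inf_zero f p q g \<longrightarrow>
        germ (negate_y (assoc_curve g (q - p))) = germ (sigma2 (assoc_curve f q)))) \<and>
     (\<forall>g. lft_zero_inf f p q g \<longrightarrow>
        germ (negate_x (assoc_curve f q)) = germ (sigma2 (assoc_curve g (p + q)))) \<and>
     (q < p \<longrightarrow> (\<forall>g. lft_inf_inf f p q g \<longrightarrow>
        germ (negate_y (assoc_curve g (p - q))) = sigma3 (assoc_curve f q)))"
proof (intro conjI allI impI)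
  have f_nz: "f \<noteq> 0" using assms(2) by auto
  obtain F where F: "inverse f = fps_to_fls F" "subdegree F = p"
    using inverse_fls_conv_fps[OF assms(3)] .
  have F_nz: "F \<noteq> 0" using F f_nz by auto
  have fF: "f * fps_to_fls F = 1" using f_nz by (simp flip: F(1))
  have stab: "trivial_stabilizer q F"
    using trivial_stabilizer_of_R_o[OF _ assms(1) F(1)] assms(2) by simp
  have F0: "fps_nth F 0 = 0" if "p > 0" using that F(2) by (metis nth_less_subdegree_zero)
  note compose = compose_uniformizer_inverse[OF _ F(1) assms(3) f_nz]
  have X_fls: "fls_X ^ n = fps_to_fls (fps_X ^ n)" for n :: nat
    by (simp add: fps_to_fls_power)
  have C: "branch F q (assoc_curve f q)" if "p > 0"
    using branch_assoc_curve[OF F(1) assms(3,1) stab F0[OF that]] .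
  have unit: "assoc_curve f q dvd 1" if "p = 0"
    using that assms f_nz by (intro assoc_curve_unit) simp_all
  {

    \<comment> \<open>The transform from infinity to zero\<close>
    fix g assume pq: "p < q" and "lft_inf_zero f p q g"
    then obtain th where th: "uniformizer th" "fps_to_fls th ^ (q - p) = fls_X ^ q * f"
      and g: "g = - fls_compose_fps f (fps_inv th)" by (auto simp: lft_inf_zero_def)
    note inv = uniformizer_inv[OF th(1)]
    note comp = compose[OF inv(1)]
    define m where "m = q - p"
    have m: "m > 0" using pq by (simp add: m_def)
    have 0: "fps_nth th 0 = 0" "fps_nth (fps_inv th) 0 = 0"
      using th inv by (simp_all add: uniformizer_def)
    \<comment> \<open>With F = 1/f the equation for theta reads theta^m = t^q / F, the quotient X/Y
      produced by \<open>sigma2\<close>.\<close>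
    have "fps_to_fls (th ^ m * F) = fls_X ^ q * (f * fps_to_fls F)"
      using th(2) by (simp add: m_def fls_times_fps_to_fls fps_to_fls_power mult.assoc)
    hence "fps_to_fls (th ^ m * F) = fps_to_fls (fps_X ^ q)" by (simp only: fF X_fls mult_1_right)
    hence thF: "th ^ m * F = fps_X ^ q" by (simp only: fps_to_fls_eq_iff)
    have "germ (negate_y (assoc_curve g m)) = germ (assoc_curve (- g) m)"
      using comp(2) m by (intro germ_negate_y_assoc_curve[of _ _ p]) (simp_all add: g)
    also have "\<dots> = germ (sigma2 (assoc_curve f q))"
    proof (cases "p = 0")
      case True
      \<comment> \<open>For p = 0 both sides are units and therefore define the same germ.\<close>
      have "assoc_curve (- g) m dvd 1"
        using comp True m by (intro assoc_curve_unit) (simp_all add: g)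
      thus ?thesis using germ_of_units sigma2_unit unit True by blast
    next
      case False
      interpret C: branch F q "assoc_curve f q" using C False by simp
      have stab': "trivial_stabilizer m (F oo fps_inv th)"
      proof (rule trivial_stabilizer_transfer[OF stab th(1) assms(1)])
        fix u assume u: "fps_nth u 0 = 0" "F oo u = F" "(th oo u) ^ m = th ^ m"
        have "u ^ q = th ^ m * F oo u" by (simp add: thF fps_X_power_compose[OF u(1)])
        also have "\<dots> = th ^ m * F"
          unfolding fps_compose_mult_distrib[OF u(1)] fps_compose_power[OF u(1), symmetric] u(2,3) ..
        finally show "u ^ q = fps_X ^ q" by (simp add: thF)
      qed
      interpret C': branch "F oo fps_inv th" m "assoc_curve (- g) m"
        using comp m stab' False F0 by (intro branch_assoc_curve[of _ _ p]) (simp_all add: g)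
      have "eval_at (assoc_curve f q) (th ^ m * F) F = 0"
        using C.eval_at_curve by (simp add: thF)
      hence "eval_at (sigma2 (assoc_curve f q)) (th ^ m) F = 0"
        using 0 m F_nz C.F_0 by (intro eval_at_sigma2_eq_0) (simp_all add: fps_nth_power_0)
      hence "eval_at (sigma2 (assoc_curve f q)) (th ^ m oo fps_inv th) (F oo fps_inv th) = 0"
        using 0 m C.F_0 by (simp add: eval_at_compose fps_nth_power_0)
      hence "eval_at (sigma2 (assoc_curve f q)) (fps_X ^ m) (F oo fps_inv th) = 0"
        by (simp add: inv(2) flip: fps_compose_power[OF 0(2)])
      thus ?thesis
        using C.coeff_subst_0_sigma2[OF F(2) pq F_nz]
        by (intro C'.germ_eqI[symmetric]) (simp_all add: m_def)
    qed
    finally show "germ (negate_y (assoc_curve g (q - p))) = germ (sigma2 (assoc_curve f q))"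
      by (simp add: m_def)
  }
  {

    \<comment> \<open>The transform from zero to infinity\<close>
    fix g assume "lft_zero_inf f p q g"
    then obtain th where th: "uniformizer th" "fps_to_fls th ^ (p + q) = - (fls_X ^ q / f)"
      and g: "g = fls_compose_fps f (fps_inv th)" by (auto simp: lft_zero_inf_def)
    note inv = uniformizer_inv[OF th(1)]
    note comp = compose[OF inv(1)]
    define m where "m = p + q"
    have m: "m > 0" using assms(1) by (simp add: m_def)
    have 0: "fps_nth th 0 = 0" "fps_nth (fps_inv th) 0 = 0"
      using th inv by (auto simp: uniformizer_def)
    \<comment> \<open>Here theta^m = -t^q F, so the roles are exchanged: dividing the first
      coordinate of the branch of g by the second gives -t^q, whence the sign change in x.\<close>
    have "fps_to_fls (th ^ m) = fps_to_fls (- (fps_X ^ q) * F)"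
      using th(2) by (simp add: m_def fls_times_fps_to_fls fps_to_fls_power F(1) divide_inverse)
    hence thF: "th ^ m = - (fps_X ^ q) * F" by (simp only: fps_to_fls_eq_iff)
    show "germ (negate_x (assoc_curve f q)) = germ (sigma2 (assoc_curve g (p + q)))"
    proof (cases "p = 0")
      case True
      have "assoc_curve g m dvd 1"
        using comp True m by (intro assoc_curve_unit) (simp_all add: g)
      thus ?thesis using germ_of_units sigma2_unit negate_x_unit unit True by (metis m_def)
    next
      case False
      interpret C: branch F q "assoc_curve f q" using C False by simp
      have stab': "trivial_stabilizer m (F oo fps_inv th)"
      proof (rule trivial_stabilizer_transfer[OF stab th(1) assms(1)])
        fix u assume u: "fps_nth u 0 = 0" "F oo u = F" "(th oo u) ^ m = th ^ m"
        have "- (fps_X ^ q) * F = th ^ m oo u"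
          using u(3) by (simp only: fps_compose_power[OF u(1)] thF[symmetric])
        also have "\<dots> = (- (fps_X ^ q) oo u) * (F oo u)"
          unfolding thF by (rule fps_compose_mult_distrib[OF u(1)])
        also have "\<dots> = - (u ^ q) * F"
          by (simp add: u(2) fps_compose_uminus fps_X_power_compose[OF u(1)])
        finally show "u ^ q = fps_X ^ q" using F_nz by simp
      qed
      interpret C': branch "F oo fps_inv th" m "assoc_curve g m"
        using comp m stab' False F0 by (intro branch_assoc_curve[of _ _ p]) (simp_all add: g)
      define S where "S = sigma2 (assoc_curve g m)"
      have "th oo fps_inv th = fps_X" by (rule inv)
      hence "eval_at (assoc_curve g m) (th ^ m oo fps_inv th) (F oo fps_inv th) = 0"
        using C'.eval_at_curve by (simp flip: fps_compose_power[OF 0(2)])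
      hence "eval_at (assoc_curve g m) (th ^ m) F = 0"
        using 0 m C.F_0 inv(1)
        by (subst (asm) eval_at_compose_eq_0_iff) (auto simp: fps_nth_power_0 uniformizer_def)
      hence "eval_at S (- (fps_X ^ q)) F = 0"
        unfolding S_def thF using C.X_power_0 C.F_0 F_nz by (intro eval_at_sigma2_eq_0) simp_all
      hence "eval_at (negate_x S) (fps_X ^ q) F = 0"
        by (simp only: eval_at_negate_x[OF C.X_power_0])
      moreover have "coeff_subst 0 (negate_x S) = fps_X ^ q"
      proof -
        \<comment> \<open>The order p is below m = p + q, so the strict transform restricts to y^(m
          - p) = y^q.\<close>
        have "subdegree (F oo fps_inv th) = p" "F oo fps_inv th \<noteq> 0"
          using comp(4) False by auto
        hence "coeff_subst 0 S = fps_X ^ (m - p)"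
          unfolding S_def using assms(1) by (intro C'.coeff_subst_0_sigma2) (simp_all add: m_def)
        thus ?thesis
          by (simp add: m_def negate_x_conv_coeff_subst coeff_subst_coeff_subst)
      qed
      ultimately have "germ (negate_x S) = germ (assoc_curve f q)" by (rule C.germ_eqI)
      \<comment> \<open>The sign change is an involution preserving products and units, so it can be
        moved to the other side.\<close>
      hence "negate_x S \<in> germ (assoc_curve f q)"
        unfolding germ_def by (metis (mono_tags, lifting) dvd_refl mem_Collect_eq mult_1)
      then obtain u where u: "negate_x S = u * assoc_curve f q" "u dvd 1" by (auto simp: germ_def)
      have "S = negate_x u * negate_x (assoc_curve f q)"
        using u(1) by (metis negate_x_mult negate_x_negate_x)
      thus ?thesis
        using germ_unit_mult[OF negate_x_unit[OF u(2)]] by (simp add: S_def m_def)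
    qed
  }
  {

    \<comment> \<open>The transform from infinity to infinity\<close>
    fix g assume pq: "q < p" and "lft_inf_inf f p q g"
    then obtain th where th: "uniformizer th" "fps_to_fls th ^ (p - q) = 1 / (fls_X ^ q * f)"
      and g: "g = - fls_compose_fps f (fps_inv th)" by (auto simp: lft_inf_inf_def)
    note inv = uniformizer_inv[OF th(1)]
    note comp = compose[OF inv(1)]
    define m where "m = p - q"
    have m: "m > 0" "p > 0" using pq by (simp_all add: m_def)
    \<comment> \<open>Now theta^m = F / t^q, the quotient Y/X produced by
      \<open>sigma3\<close>.\<close>
    have "fps_to_fls (th ^ m * fps_X ^ q) = fps_to_fls F"
      using th(2) f_nz
      by (simp add: m_def fls_times_fps_to_fls fps_to_fls_power field_simps flip: F(1))
    hence thF: "th ^ m * fps_X ^ q = F" by (simp only: fps_to_fls_eq_iff)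
    have stab': "trivial_stabilizer m (F oo fps_inv th)"
    proof (rule trivial_stabilizer_transfer[OF stab th(1) assms(1)])
      fix u assume u: "fps_nth u 0 = 0" "F oo u = F" "(th oo u) ^ m = th ^ m"
      have "th ^ m * fps_X ^ q = th ^ m * fps_X ^ q oo u" using u by (simp add: thF)
      also have "\<dots> = th ^ m * u ^ q"
        unfolding fps_compose_mult_distrib[OF u(1)] fps_compose_power[OF u(1), symmetric]
          u(3) fps_X_fps_compose_startby0[OF u(1)] ..
      finally have "th ^ m * fps_X ^ q = th ^ m * u ^ q" .
      moreover have "th ^ m \<noteq> 0" using thF F_nz by auto
      ultimately show "u ^ q = fps_X ^ q" by (metis mult_cancel_left)
    qed
    have C': "branch (F oo fps_inv th) m (assoc_curve (- g) m)"
      using comp m stab' F0 by (intro branch_assoc_curve[of _ _ p]) (simp_all add: g)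
    have "germ (negate_y (assoc_curve g m)) = germ (assoc_curve (- g) m)"
      using comp(2) m by (intro germ_negate_y_assoc_curve[of _ _ p]) (simp_all add: g)
    also have "\<dots> = sigma3 (assoc_curve f q)"
      using germ_eq_sigma3[OF C[OF m(2)] C' F(2) pq m_def th(1) thF] .
    finally show "germ (negate_y (assoc_curve g (p - q))) = sigma3 (assoc_curve f q)"
      by (simp add: m_def)
  }
qed

end
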